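(* Let $d\ge2$ be an integer, let $a \in \mathbb{R}^d$ satisfy $\bar a_k>0$ for $k=2,\dots,d$, and suppose that $\bar a_1 = -M$ for some $M \in \mathbb{N}$. For $m\in\mathbb{N}_0^d(M)$ set $$w_m = \frac{\binom{M}{m_1,\dots, m_d}\prod_{k=2}^d \frac{\bar a_k}{\bar a_k + \bar m_k}}{\sum_{l \in \mathbb{N}_0^d(M)}\binom{M}{l_1,\dots, l_d}\prod_{k=2}^d \frac{\bar a_k}{\bar a_k + \bar l_k}}.$$ Then for any function $g:\mathbb{R}^{d-1}_+ \to \mathbb{R}$ such that $g(Z)$ is $\mathbb{P}_a$-integrable, $$\mathbb{E}_{a}[g(Z)] = \sum_{m \in \mathbb{N}_0^d(M)} w_m\,\mathbb{E}_{a+m}[g(Z)].$$ In particular, the law of the log gaps $(Z_2,\dots,Z_d)$ under $\mathbb{P}_a$ is a mixture of laws of exponential random vectors with independent components: it is the mixture, with weights $w_m$, $m \in \mathbb{N}_0^d(M)$, of the laws of $(Z_2,\dots,Z_d)$ under $\mathbb{P}_{a+m}$, and under $\mathbb{P}_{a+m}$ the $Z_k$, $k=2,\dots,d$, are independent with $Z_k\sim\mathrm{Exp}(\bar a_k+\bar m_k)$.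
   Context: For a vector $v \in \mathbb{R}^d$, write $\bar v_k := v_k + v_{k+1} + \dots + v_d$ for its tail sums, $k=1,\dots,d$. $\mathbb{N} = \{1,2,\dots\}$, $\mathbb{N}_0 = \mathbb{N}\cup\{0\}$, and for $M\in\mathbb{N}$, $\mathbb{N}_0^d(M) = \{m \in \mathbb{N}_0^d : \bar m_1 = M\}$. For $m\in\mathbb{N}_0^d(M)$, $\binom{M}{m_1,\dots,m_d} = \frac{M!}{m_1!\cdots m_d!}$. $\mathrm{Exp}(\lambda)$ is the exponential distribution with rate $\lambda>0$ (density $\lambda e^{-\lambda z}$ on $z>0$). The ordered simplex is $\nabla^{d-1} = \{y \in \mathbb{R}^d: y_1 \geq y_2\geq \dots \geq y_d \geq 0,\ y_1+\dots+y_d = 1\}$. Integrals $dy$ over $\nabla^{d-1}$ are with respect to the pushforward of Lebesgue measure on $\mathbb{R}^{d-1}$ under $(y_1,\dots,y_{d-1}) \mapsto (y_1,\dots,y_{d-1},1-y_1-\dots-y_{d-1})$. For $a \in \mathbb{R}^d$ with $\bar a_k>0$ for $k=2,\dots,d$, the constant $Q_a = \int_{\nabla^{d-1}}\prod_{k=1}^d y_k^{a_k-1}\,dy$ is finite (known fact), and the Generalized Rank Dirichlet distribution GRD$(a)$ is the probability measure $\mathbb{P}_a(A) = Q_a^{-1}\int_{\nabla^{d-1}} \prod_{k=1}^d y_k^{a_k-1} 1_A(y)\,dy$ on Borel subsets $A$ of $\nabla^{d-1}$. $\mathbb{E}_a$ denotes expectation under $\mathbb{P}_a$, and $Y=(Y_1,\dots,Y_d)$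 is a random vector with law $\mathbb{P}_a$ under $\mathbb{P}_a$ (e.g. the identity map on $\nabla^{d-1}$). The log gaps are $Z=(Z_2,\dots,Z_d)$ with $Z_k = \log Y_{k-1} - \log Y_k$ for $k=2,\dots,d$ (almost surely well defined since $Y_d>0$ almost surely). *)

theory Defs
  imports "HOL-Probability.Probability"
begin

text \<open>
  A vector in \<open>d\<close>-dimensional space is a function on \<open>nat\<close> of which only the values at the
  indices \<open>1, \<dots>, d\<close> are used; where vectors are the points of a measure space or of a finite
  index set, they are extensional functions on \<open>{1..d}\<close>.
\<close>

definition tail_sum :: "nat \<Rightarrow> (nat \<Rightarrow> 'a::comm_monoid_add) \<Rightarrow> nat \<Rightarrow> 'a" where
  "tail_sum d v k = (\<Sum>i=k..d. v i)"

definition weak_compositions :: "nat \<Rightarrow> nat \<Rightarrow> (nat \<Rightarrow> nat) set" where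
  "weak_compositions d M = {m \<in> {1..d} \<rightarrow>\<^sub>E UNIV. tail_sum d m 1 = M}"

definition multinomial :: "nat \<Rightarrow> nat \<Rightarrow> (nat \<Rightarrow> nat) \<Rightarrow> real" where
  "multinomial d M m = fact M / (\<Prod>k=1..d. fact (m k))"

definition ordered_simplex :: "nat \<Rightarrow> (nat \<Rightarrow> real) set" where
  "ordered_simplex d =
     {y \<in> {1..d} \<rightarrow>\<^sub>E UNIV. (\<forall>k\<in>{1..<d}. y (Suc k) \<le> y k) \<and> 0 \<le> y d \<and> (\<Sum>k=1..d. y k) = 1}"

definition hyperplane_lebesgue :: "nat \<Rightarrow> (nat \<Rightarrow> real) measure" where
  "hyperplane_lebesgue d =
     distr (\<Pi>\<^sub>M k\<in>{1..<d}. lborel) (\<Pi>\<^sub>M k\<in>{1..d}. borel)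
       (\<lambda>y. \<lambda>k\<in>{1..d}. if k < d then y k else 1 - (\<Sum>i=1..<d. y i))"

definition simplex_lebesgue :: "nat \<Rightarrow> (nat \<Rightarrow> real) measure" where
  "simplex_lebesgue d = restrict_space (hyperplane_lebesgue d) (ordered_simplex d)"

text \<open>
  The integrand of the normalizing constant is nonnegative, so the constant is taken as a
  nonnegative extended real. The convention \<open>0 powr x = 0\<close> only affects the null set of
  vectors with a vanishing coordinate.
\<close>

definition grd_constant :: "nat \<Rightarrow> (nat \<Rightarrow> real) \<Rightarrow> ennreal" where
  "grd_constant d a =
     (\<integral>\<^sup>+ y. ennreal (\<Prod>k=1..d. y k powr (a k - 1)) \<partial>simplex_lebesgue d)"

definition GRD :: "nat \<Rightarrow> (nat \<Rightarrow> real) \<Rightarrow> (nat \<Rightarrow> real) measure" where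
  "GRD d a =
     density (simplex_lebesgue d)
       (\<lambda>y. ennreal (\<Prod>k=1..d. y k powr (a k - 1)) / grd_constant d a)"

text \<open>
  Since \<open>ln 0 = 0\<close>, the log gaps carry no meaning on the null set of vectors whose last
  coordinate vanishes.
\<close>

definition log_gaps :: "nat \<Rightarrow> (nat \<Rightarrow> real) \<Rightarrow> nat \<Rightarrow> real" where
  "log_gaps d y = (\<lambda>k\<in>{2..d}. ln (y (k - 1)) - ln (y k))"

definition log_gap_law :: "nat \<Rightarrow> (nat \<Rightarrow> real) \<Rightarrow> (nat \<Rightarrow> real) measure" where
  "log_gap_law d a = distr (GRD d a) (\<Pi>\<^sub>M k\<in>{2..d}. borel) (log_gaps d)"

definition add_counts :: "(nat \<Rightarrow> real) \<Rightarrow> (nat \<Rightarrow> nat) \<Rightarrow> nat \<Rightarrow> real" where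
  "add_counts a m = (\<lambda>k. a k + real (m k))"

definition raw_weight :: "nat \<Rightarrow> (nat \<Rightarrow> real) \<Rightarrow> nat \<Rightarrow> (nat \<Rightarrow> nat) \<Rightarrow> real" where
  "raw_weight d a M m =
     multinomial d M m *
     (\<Prod>k=2..d. tail_sum d a k / (tail_sum d a k + real (tail_sum d m k)))"

definition weight :: "nat \<Rightarrow> (nat \<Rightarrow> real) \<Rightarrow> nat \<Rightarrow> (nat \<Rightarrow> nat) \<Rightarrow> real" where
  "weight d a M m = raw_weight d a M m / (\<Sum>l\<in>weak_compositions d M. raw_weight d a M l)"

end

(*
  Since the coordinates sum to 1, multiplying the density by (y_1 + ... + y_d)^M = 1 and
  expanding writes GRD(a) as a mixture of the GRD(a + m), whose exponents have total sum 0. For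
  total sum 0 the integrand is homogeneous of degree -d, so integrating over the simplex is the
  same as integrating over a slab of the ordered cone; there x_k = x_{k-1} exp(-z_k) turns it
  into a product of exponential densities, with no Jacobian determinant to compute.
*)
theory Submission
  imports Defs
begin

text \<open>On the simplex the largest coordinate is \<open>1 / c\<close>, where
  \<open>c = 1 + exp (- z 2) + exp (- z 2 - z 3) + ...\<close> depends on all gaps. In gap
  coordinates the integrand for an exponent vector \<open>b\<close> is a product of exponentials
  times \<open>c\<close> to the power \<open>- tail_sum d b 1\<close>, and this power is what ties
  the gaps together. For total 0 it is trivial; the slab makes that visible, since the scale
  \<open>t\<close> runs from \<open>1 / c\<close> to \<open>exp 1 / c\<close> against
  \<open>dt / t\<close>, which has mass 1 whatever \<open>c\<close> is. For total \<open>- M\<close>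
  the power is \<open>c ^ M\<close>, whose multinomial expansion is the mixture. The weights come
  from the constants: for \<open>a + m\<close> the constant is the product of the reciprocal rates,
  the constant for \<open>a\<close> is the multinomial sum of these, and \<open>w_m\<close> is the
  share of the term \<open>m\<close> in it. Finiteness of the constants is obtained along the way
  rather than assumed. The changes of variables are made for nonnegative integrals, so no
  integrability has to be known beforehand; Bochner integrals enter only with the expectation
  formula.\<close>

section \<open>Substitution and scaling in Lebesgue integrals\<close>

interpretation lborel_prod: product_sigma_finite "\<lambda>_::nat. lborel :: real measure"
  by standard

text \<open>Substitution is done on compact intervals that exhaust both domains, and monotone
  convergence does the rest; reading the integrals as measures of a \<open>density\<close> turns it
  into continuity from below. The interval is open at 0 because 0 is only the limit for large
  \<open>z\<close>.\<close>

lemma nn_integral_exp_substitution: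
  fixes h :: "real \<Rightarrow> ennreal"
  assumes [measurable]: "h \<in> borel_measurable borel" and t: "0 < t"
  shows "(\<integral>\<^sup>+x. h x * indicator {0<..t} x \<partial>lborel) =
    (\<integral>\<^sup>+z. h (t * exp (- z)) * ennreal (t * exp (- z)) * indicator {0..} z \<partial>lborel)"
proof -
  let ?k = "\<lambda>z. h (t * exp z) * ennreal (t * exp z)"
  \<comment> \<open>\<open>Suc n\<close> keeps all intervals nondegenerate.\<close>
  define A where "A n = {t * exp (- real (Suc n))..t}" for n
  define B where "B n = {- real (Suc n)..0}" for n
  have "filterlim (\<lambda>n. t * exp (- real (Suc n))) (nhds 0) sequentially"
    using t by real_asymp
  then have small: "\<exists>n. t * exp (- real (Suc n)) \<le> x" if "0 < x" for x
    using order_tendstoD(2)[of _ 0 sequentially x] that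
    by (metis (no_types, lifting) eventually_at_top_linorder less_imp_le order_refl)
  have A: "(\<Union>n. A n) = {0<..t}"
  proof (intro equalityI subsetI)
    fix x assume "x \<in> (\<Union>n. A n)"
    then obtain n where "t * exp (- real (Suc n)) \<le> x" "x \<le> t" by (auto simp: A_def)
    moreover have "0 < t * exp (- real (Suc n))" using t by simp
    ultimately show "x \<in> {0<..t}" by (simp del: of_nat_Suc)
  qed (use small in \<open>auto simp: A_def simp del: of_nat_Suc\<close>)
  have B: "(\<Union>n. B n) = {..0}"
  proof (intro equalityI subsetI)
    fix x :: real assume "x \<in> {..0}"
    moreover obtain n where "- x \<le> real n" using real_arch_simple by blast
    ultimately show "x \<in> (\<Union>n. B n)" by (auto simp: B_def intro!: exI[of _ n])
  qed (auto simp: B_def)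
  have incA: "incseq A"
    using t by (auto simp: A_def incseq_def intro: order_trans[rotated])
  have incB: "incseq B"
    by (auto simp: B_def incseq_def)
  have "(\<integral>\<^sup>+x. h x * indicator {0<..t} x \<partial>lborel) = emeasure (density lborel h) (\<Union>n. A n)"
    by (subst emeasure_density) (auto simp: A)
  also have "\<dots> = (SUP n. emeasure (density lborel h) (A n))"
    by (rule SUP_emeasure_incseq[symmetric]) (use incA in \<open>auto simp: A_def[abs_def] simp del: of_nat_Suc\<close>)
  also have "\<dots> = (SUP n. emeasure (density lborel ?k) (B n))"
  proof (rule SUP_cong[OF refl])
    fix n
    have "(\<integral>\<^sup>+x. h x * indicator {t * exp (- real (Suc n))..t * exp 0} x \<partial>lborel) =
      (\<integral>\<^sup>+z. h (t * exp z) * ennreal (t * exp z) * indicator {- real (Suc n)..0} z \<partial>lborel)"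
      by (rule nn_integral_substitution_aux[where g'="\<lambda>z. t * exp z"])
         (use t in \<open>auto intro!: derivative_eq_intros continuous_intros\<close>)
    then show "emeasure (density lborel h) (A n) = emeasure (density lborel ?k) (B n)"
      by (simp add: emeasure_density A_def B_def)
  qed
  also have "\<dots> = emeasure (density lborel ?k) (\<Union>n. B n)"
    by (rule SUP_emeasure_incseq) (use incB in \<open>auto simp: B_def[abs_def] simp del: of_nat_Suc\<close>)
  also have "\<dots> = (\<integral>\<^sup>+z. ?k z * indicator {..0} z \<partial>lborel)"
    by (subst emeasure_density) (auto simp: B)
  also have "\<dots> = (\<integral>\<^sup>+z. ?k (- z) * indicator {0..} z \<partial>lborel)"
    by (subst nn_integral_real_affine[where c="-1" and t=0])
       (auto intro!: nn_integral_cong simp: indicator_def)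
  finally show ?thesis .
qed

text \<open>The measure \<open>dx / x\<close> is invariant under scaling: the logarithmic length of
  \<open>{1 / c..exp 1 / c}\<close> does not depend on \<open>c\<close>, and the endpoint
  \<open>exp 1\<close> is chosen to make it 1. The indicator also removes all
  \<open>x \<le> 0\<close>.\<close>

lemma nn_integral_inverse_scaled_interval:
  fixes c :: real
  assumes c: "0 < c"
  shows "(\<integral>\<^sup>+x. ennreal (indicator {1..exp 1} (x * c) / x) \<partial>lborel) = 1"
proof -
  have "(\<integral>\<^sup>+x. ennreal (indicator {1..exp 1} (x * c) / x) \<partial>lborel) =
      (\<integral>\<^sup>+x. ennreal (1 / x) * indicator {1 / c..exp 1 / c} x \<partial>lborel)"
    using c by (intro nn_integral_cong) (auto simp: indicator_def field_simps)
  also have "\<dots> = ennreal (ln (exp 1 / c) - ln (1 / c))"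
  proof (rule nn_integral_FTC_Icc)
    fix x assume "x \<in> {1 / c..exp 1 / c}"
    then have "1 / c \<le> x" by simp
    then have "0 < x" using c by (meson divide_pos_pos less_le_trans zero_less_one)
    then show "DERIV ln x :> 1 / x" "0 \<le> 1 / x"
      using DERIV_ln_divide by auto
  qed (use c in \<open>auto intro!: divide_right_mono\<close>)
  also have "ln (exp 1 / c) - ln (1 / c) = 1"
    using c by (simp add: ln_div)
  finally show ?thesis by simp
qed

text \<open>Fubini isolates one coordinate, where a factor \<open>c\<close> comes from the affine
  substitution on the line; the induction hypothesis, used for the function with that coordinate
  integrated out, scales the rest.\<close>

lemma nn_integral_PiM_lborel_scale:
  fixes c :: real
  assumes "finite I" and c: "0 < c" and "f \<in> borel_measurable (PiM I (\<lambda>_. lborel))"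
  shows "(\<integral>\<^sup>+x. f x \<partial>PiM (I :: nat set) (\<lambda>_. lborel)) =
    ennreal (c ^ card I) * (\<integral>\<^sup>+x. f (\<lambda>i\<in>I. c * x i) \<partial>PiM I (\<lambda>_. lborel))"
  using assms(1,3)
proof (induction I arbitrary: f rule: finite_induct)
  case empty
  then show ?case by (simp add: PiM_empty nn_integral_count_space_finite)
next
  case (insert i I)
  note [measurable] = insert.prems
  interpret I: finite_product_sigma_finite "\<lambda>_::nat. lborel :: real measure" I
    by standard fact
  have "(\<integral>\<^sup>+x. f x \<partial>PiM (insert i I) (\<lambda>_. lborel)) =
      (\<integral>\<^sup>+x. (\<integral>\<^sup>+y. f (x(i := y)) \<partial>lborel) \<partial>PiM I (\<lambda>_. lborel))"
    by (rule lborel_prod.product_nn_integral_insert) (use insert in auto)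
  also have "\<dots> = (\<integral>\<^sup>+x. ennreal c * (\<integral>\<^sup>+y. f (x(i := c * y)) \<partial>lborel) \<partial>PiM I (\<lambda>_. lborel))"
  proof (rule nn_integral_cong)
    fix x assume [measurable]: "x \<in> space (PiM I (\<lambda>_. lborel :: real measure))"
    show "(\<integral>\<^sup>+y. f (x(i := y)) \<partial>lborel) = ennreal c * (\<integral>\<^sup>+y. f (x(i := c * y)) \<partial>lborel)"
      using c by (subst nn_integral_real_affine[where c=c and t=0]) auto
  qed
  also have "\<dots> = ennreal c * (\<integral>\<^sup>+x. (\<integral>\<^sup>+y. f (x(i := c * y)) \<partial>lborel) \<partial>PiM I (\<lambda>_. lborel))"
    by (rule nn_integral_cmult) measurable
  also have "(\<integral>\<^sup>+x. (\<integral>\<^sup>+y. f (x(i := c * y)) \<partial>lborel) \<partial>PiM I (\<lambda>_. lborel)) =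
      ennreal (c ^ card I) *
      (\<integral>\<^sup>+x. (\<integral>\<^sup>+y. f ((\<lambda>j\<in>I. c * x j)(i := c * y)) \<partial>lborel) \<partial>PiM I (\<lambda>_. lborel))"
    by (rule insert.IH) measurable
  also have "(\<integral>\<^sup>+x. (\<integral>\<^sup>+y. f ((\<lambda>j\<in>I. c * x j)(i := c * y)) \<partial>lborel) \<partial>PiM I (\<lambda>_. lborel)) =
      (\<integral>\<^sup>+x. (\<integral>\<^sup>+y. f (\<lambda>j\<in>insert i I. c * (x(i := y)) j) \<partial>lborel) \<partial>PiM I (\<lambda>_. lborel))"
    using insert.hyps
    by (intro nn_integral_cong arg_cong[where f=f]) (auto simp: restrict_def fun_eq_iff)
  also have "\<dots> = (\<integral>\<^sup>+x. f (\<lambda>j\<in>insert i I. c * x j) \<partial>PiM (insert i I) (\<lambda>_. lborel))"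
    by (rule lborel_prod.product_nn_integral_insert[symmetric]) (use insert in auto)
  finally show ?case
    using insert.hyps c by (simp add: ennreal_mult mult.assoc del: restrict_apply)
qed

section \<open>The ordered cone in gap coordinates\<close>

text \<open>Positivity of the last coordinate forces that of the others, so logarithms of
  coordinates are genuine here, in contrast to \<open>ordered_simplex\<close>. Extensionality is
  left to the product space.\<close>

definition positive_cone :: "nat \<Rightarrow> (nat \<Rightarrow> real) set" where
  "positive_cone d = {x. (\<forall>k\<in>{1..<d}. x (Suc k) \<le> x k) \<and> 0 < x d}"

text \<open>Inverse of the map that sends \<open>x\<close> to its first coordinate and its log gaps:
  the sum is empty for \<open>k = 1\<close>, so the first coordinate is \<open>t\<close>.\<close>

definition from_gaps :: "nat \<Rightarrow> real \<Rightarrow> (nat \<Rightarrow> real) \<Rightarrow> nat \<Rightarrow> real" where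
  "from_gaps d t z = (\<lambda>k\<in>{1..d}. t * exp (- (\<Sum>j=2..k. z j)))"

lemma measurable_coordinate:
  "k \<in> I \<Longrightarrow> (\<lambda>x. x k) \<in> borel_measurable (PiM I (\<lambda>_. lborel :: real measure))"
  using measurable_component_singleton[of k I "\<lambda>_. lborel :: real measure"] by simp

lemma measurable_indicator_positive_cone [measurable]:
  assumes "d \<ge> 1"
  shows "(\<lambda>x. indicator (positive_cone d) x :: ennreal) \<in> borel_measurable (PiM {1..d} (\<lambda>_. lborel))"
proof -
  have "Measurable.pred (PiM {1..d} (\<lambda>_. lborel :: real measure)) (\<lambda>x. x (Suc k) \<le> x k)"
    if "k \<in> {1..<d}" for k
    using that unfolding pred_def by (intro borel_measurable_le measurable_coordinate) auto
  then have "{x \<in> space (PiM {1..d} (\<lambda>_. lborel :: real measure)).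
      (\<forall>k\<in>{1..<d}. x (Suc k) \<le> x k) \<and> 0 < x d} \<in> sets (PiM {1..d} (\<lambda>_. lborel))"
    using assms
    by (intro sets.sets_Collect_conj sets.sets_Collect_finite_All borel_measurable_less measurable_coordinate)
      (auto simp: pred_def)
  also have "{x \<in> space (PiM {1..d} (\<lambda>_. lborel :: real measure)).
      (\<forall>k\<in>{1..<d}. x (Suc k) \<le> x k) \<and> 0 < x d} =
      positive_cone d \<inter> space (PiM {1..d} (\<lambda>_. lborel))"
    by (auto simp: positive_cone_def)
  finally show ?thesis
    by (simp add: borel_measurable_indicator_iff)
qed

lemma measurable_from_gaps [measurable]:
  "(\<lambda>(t, z). from_gaps d t z) \<in>
    measurable (lborel \<Otimes>\<^sub>M PiM {2..d} (\<lambda>_. lborel)) (PiM {1..d} (\<lambda>_. lborel))"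
proof -
  have "(\<lambda>p. \<lambda>k\<in>{1..d}. fst p * exp (- (\<Sum>j=2..k. snd p j))) \<in>
    measurable (lborel \<Otimes>\<^sub>M PiM {2..d} (\<lambda>_. lborel :: real measure)) (PiM {1..d} (\<lambda>_. lborel))"
    by (intro measurable_restrict) auto
  then show ?thesis
    by (simp add: from_gaps_def case_prod_beta')
qed

lemma positive_cone_pos: "x \<in> positive_cone d \<Longrightarrow> k \<in> {1..d} \<Longrightarrow> 0 < x k"
proof -
  assume x: "x \<in> positive_cone d" and k: "k \<in> {1..d}"
  from k have "k \<le> d" by simp
  then show ?thesis
  proof (induction rule: inc_induct)
    case base
    then show ?case using x by (simp add: positive_cone_def)
  next
    case (step n)
    then have "x (Suc n) \<le> x n" using x k by (auto simp: positive_cone_def)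
    then show ?case using step by simp
  qed
qed

text \<open>Exhibits the fibres over the new coordinate as the intervals on which
  \<open>nn_integral_exp_substitution\<close> works.\<close>

lemma positive_cone_Suc:
  assumes "1 \<le> d"
  shows "x(Suc d := w) \<in> positive_cone (Suc d) \<longleftrightarrow> x \<in> positive_cone d \<and> w \<in> {0<..x d}"
proof -
  have "{1..<Suc d} = insert d {1..<d}" using assms by auto
  then show ?thesis by (auto simp: positive_cone_def)
qed

lemma from_gaps_Suc:
  assumes "1 \<le> d"
  shows "from_gaps (Suc d) t (z(Suc d := v)) =
    (from_gaps d t z)(Suc d := from_gaps d t z d * exp (- v))"
proof
  fix k
  have "{2..Suc d} = insert (Suc d) {2..d}" using assms by auto
  moreover have "(\<Sum>j=2..d. (z(Suc d := v)) j) = (\<Sum>j=2..d. z j)"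
    by (rule sum.cong) auto
  moreover have "(\<Sum>j=2..k. (z(Suc d := v)) j) = (\<Sum>j=2..k. z j)" if "k \<le> d"
    using that by (intro sum.cong) auto
  ultimately show "from_gaps (Suc d) t (z(Suc d := v)) k =
      ((from_gaps d t z)(Suc d := from_gaps d t z d * exp (- v))) k"
    using assms by (auto simp: from_gaps_def le_Suc_eq exp_add exp_minus field_simps)
qed

text \<open>
  The substitution \<open>x k = x (k - 1) * exp (- z k)\<close> is triangular, so it is carried out
  one coordinate at a time.
\<close>

lemma nn_integral_positive_cone:
  assumes "1 \<le> d" and "G \<in> borel_measurable (PiM {1..d} (\<lambda>_. lborel))"
  shows "(\<integral>\<^sup>+x. G x * indicator (positive_cone d) x \<partial>PiM {1..d} (\<lambda>_. lborel)) =
    (\<integral>\<^sup>+t. (\<integral>\<^sup>+z. G (from_gaps d t z) *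
      (\<Prod>k=2..d. ennreal (from_gaps d t z k) * indicator {0..} (z k))
      \<partial>PiM {2..d} (\<lambda>_. lborel)) * indicator {0<..} t \<partial>lborel)"
  using assms
proof (induction d arbitrary: G rule: nat_induct_at_least)
  case base
  note [measurable] = base
  have "(\<integral>\<^sup>+x. G x * indicator (positive_cone 1) x \<partial>PiM (insert 1 {}) (\<lambda>_. lborel)) =
    (\<integral>\<^sup>+x. (\<integral>\<^sup>+y. G (x(1 := y)) * indicator (positive_cone 1) (x(1 := y)) \<partial>lborel)
      \<partial>PiM {} (\<lambda>_. lborel))"
  proof (rule lborel_prod.product_nn_integral_insert)
    show "(\<lambda>x. G x * indicator (positive_cone 1) x) \<in>
        borel_measurable (PiM (insert 1 {}) (\<lambda>_. lborel))"
      using base measurable_indicator_positive_cone[of 1] by auto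
  qed auto
  also have "\<dots> = (\<integral>\<^sup>+y. G ((\<lambda>_. undefined)(1 := y)) * indicator {0<..} y \<partial>lborel)"
    by (auto simp: PiM_empty nn_integral_count_space_finite positive_cone_def indicator_def fun_upd_def
        intro!: nn_integral_cong)
  also have "(\<lambda>y. (\<lambda>_. undefined)(1 := y)) = (\<lambda>y. from_gaps 1 y (\<lambda>_. undefined))"
    by (auto simp: from_gaps_def fun_eq_iff)
  finally show ?case
    by (simp add: PiM_empty nn_integral_count_space_finite)
next
  case (Suc d)
  note [measurable] = Suc.prems
  have d: "1 \<le> d" by fact
  note [measurable] = measurable_indicator_positive_cone[OF d]
  have ins1: "{1..Suc d} = insert (Suc d) {1..d}" and ins2: "{2..Suc d} = insert (Suc d) {2..d}"
    using d by auto
  have G: "G \<in> borel_measurable (PiM (insert (Suc d) {1..d}) (\<lambda>_. lborel))"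
    using Suc.prems unfolding ins1 .
  note [measurable] = G measurable_coordinate[of d "{1..d}"]
  let ?L = "\<lambda>I. PiM I (\<lambda>_::nat. lborel :: real measure)"
  \<comment> \<open>\<open>G'\<close> is \<open>G\<close> with the last gap integrated out. The
    induction hypothesis is applied to it, which is why \<open>G\<close> is arbitrary in the
    induction.\<close>
  define G' where "G' x = (\<integral>\<^sup>+v. G (x(Suc d := x d * exp (- v))) * ennreal (x d * exp (- v)) *
    indicator {0..} v \<partial>lborel)" for x
  have snd: "snd \<in> borel_measurable (?L {1..d} \<Otimes>\<^sub>M (lborel :: real measure))"
    using measurable_snd[of "?L {1..d}" "lborel :: real measure"] by simp
  have "(\<lambda>p. fst p d) \<in> borel_measurable (?L {1..d} \<Otimes>\<^sub>M (lborel :: real measure))"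
    by (rule measurable_compose[OF measurable_fst measurable_coordinate]) (use d in auto)
  then have xv: "(\<lambda>p. fst p d * exp (- snd p)) \<in> borel_measurable (?L {1..d} \<Otimes>\<^sub>M lborel)"
    using snd by (intro borel_measurable_times borel_measurable_exp borel_measurable_uminus) auto
  have upd: "(\<lambda>(x, v). x(Suc d := x d * exp (- v))) \<in>
      measurable (?L {1..d} \<Otimes>\<^sub>M lborel) (?L (insert (Suc d) {1..d}))"
  proof -
    have [measurable]: "(\<lambda>p. fst p d * exp (- snd p)) \<in> borel_measurable (?L {1..d} \<Otimes>\<^sub>M lborel)"
      by (rule xv)
    show ?thesis
      unfolding case_prod_beta' by measurable
  qed
  note [measurable] = upd
  have G'[measurable]: "G' \<in> borel_measurable (?L {1..d})"
  proof -
    have "(\<lambda>p. G ((fst p)(Suc d := fst p d * exp (- snd p))) * ennreal (fst p d * exp (- snd p)) *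
        indicator {0..} (snd p)) \<in> borel_measurable (?L {1..d} \<Otimes>\<^sub>M lborel)"
      using measurable_compose[OF upd G] xv
      by (intro borel_measurable_times_ennreal measurable_compose[OF _ measurable_ennreal]
          measurable_compose[OF snd borel_measurable_indicator]) (auto simp: case_prod_beta')
    then show ?thesis
      unfolding G'_def by (intro lborel.borel_measurable_nn_integral) (simp add: case_prod_beta')
  qed
  have fub: "(\<integral>\<^sup>+w. G (x(Suc d := w)) * indicator (positive_cone (Suc d)) (x(Suc d := w)) \<partial>lborel) =
      G' x * indicator (positive_cone d) x" if x: "x \<in> space (?L {1..d})" for x
  proof (cases "x \<in> positive_cone d")
    case True
    then have xd: "0 < x d" by (simp add: positive_cone_def)
    have "(\<integral>\<^sup>+w. G (x(Suc d := w)) * indicator (positive_cone (Suc d)) (x(Suc d := w)) \<partial>lborel) =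
      (\<integral>\<^sup>+w. G (x(Suc d := w)) * indicator {0<..x d} w \<partial>lborel)"
      using True by (intro nn_integral_cong) (simp add: positive_cone_Suc[OF d] indicator_def)
    also have "\<dots> = G' x"
      unfolding G'_def
    proof (rule nn_integral_exp_substitution[OF _ xd])
      show "(\<lambda>w. G (x(Suc d := w))) \<in> borel_measurable borel"
        using measurable_compose[OF measurable_component_update[OF x, of "Suc d"] G] by simp
    qed
    finally show ?thesis using True by simp
  qed (simp add: positive_cone_Suc[OF d])
  have "(\<integral>\<^sup>+x. G x * indicator (positive_cone (Suc d)) x \<partial>?L {1..Suc d}) =
    (\<integral>\<^sup>+x. (\<integral>\<^sup>+w. G (x(Suc d := w)) * indicator (positive_cone (Suc d)) (x(Suc d := w)) \<partial>lborel)
      \<partial>?L {1..d})"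
    unfolding ins1
  proof (rule lborel_prod.product_nn_integral_insert)
    show "(\<lambda>x. G x * indicator (positive_cone (Suc d)) x) \<in>
        borel_measurable (PiM (insert (Suc d) {1..d}) (\<lambda>_. lborel))"
      using G measurable_indicator_positive_cone[of "Suc d"] unfolding ins1 by auto
  qed auto
  also have "\<dots> = (\<integral>\<^sup>+x. G' x * indicator (positive_cone d) x \<partial>?L {1..d})"
    by (rule nn_integral_cong) (rule fub)
  also have "\<dots> = (\<integral>\<^sup>+t. (\<integral>\<^sup>+z. G' (from_gaps d t z) *
      (\<Prod>k=2..d. ennreal (from_gaps d t z k) * indicator {0..} (z k)) \<partial>?L {2..d}) *
      indicator {0<..} t \<partial>lborel)"
    by (rule Suc.IH) fact
  also have "\<dots> = (\<integral>\<^sup>+t. (\<integral>\<^sup>+z. G (from_gaps (Suc d) t z) *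
      (\<Prod>k=2..Suc d. ennreal (from_gaps (Suc d) t z k) * indicator {0..} (z k)) \<partial>?L {2..Suc d}) *
      indicator {0<..} t \<partial>lborel)"
  proof (rule nn_integral_cong)
    \<comment> \<open>The inner integrals agree for every real \<open>t\<close>, so the indicator of
      positive \<open>t\<close> is only carried along.\<close>
    fix t :: real
    let ?H = "\<lambda>z. G (from_gaps (Suc d) t z) *
      (\<Prod>k=2..Suc d. ennreal (from_gaps (Suc d) t z k) * indicator {0..} (z k))"
    have FS: "from_gaps (Suc d) t \<in> measurable (?L {2..Suc d}) (?L {1..Suc d})"
      using measurable_compose[OF measurable_Pair1' measurable_from_gaps] by simp
    have "(\<lambda>z. from_gaps (Suc d) t z k) \<in> borel_measurable (?L {2..Suc d})" if "k \<in> {2..Suc d}" for k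
      using that by (intro measurable_compose[OF FS measurable_coordinate]) auto
    moreover have "(\<lambda>z. G (from_gaps (Suc d) t z)) \<in> borel_measurable (?L {2..Suc d})"
      by (rule measurable_compose[OF FS Suc.prems])
    ultimately have "?H \<in> borel_measurable (?L {2..Suc d})"
      by (intro borel_measurable_times_ennreal borel_measurable_prod_ennreal measurable_compose[OF _ measurable_ennreal]
          measurable_compose[OF measurable_coordinate borel_measurable_indicator]) auto
    then have "(\<integral>\<^sup>+z. ?H z \<partial>?L {2..Suc d}) =
        (\<integral>\<^sup>+z. (\<integral>\<^sup>+v. ?H (z(Suc d := v)) \<partial>lborel) \<partial>?L {2..d})"
      unfolding ins2 by (intro lborel_prod.product_nn_integral_insert) auto
    also have "\<dots> = (\<integral>\<^sup>+z. G' (from_gaps d t z) *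
      (\<Prod>k=2..d. ennreal (from_gaps d t z k) * indicator {0..} (z k)) \<partial>?L {2..d})"
    proof (rule nn_integral_cong)
      fix z assume z: "z \<in> space (?L {2..d})"
      let ?p = "\<Prod>k=2..d. ennreal (from_gaps d t z k) * indicator {0..} (z k)"
      let ?f = "\<lambda>v. G ((from_gaps d t z)(Suc d := from_gaps d t z d * exp (- v))) *
        ennreal (from_gaps d t z d * exp (- v)) * indicator {0..} v"
      \<comment> \<open>The new coordinate is \<open>from_gaps d t z d * exp (- v)\<close>, so its
        factor in the product is the derivative factor of the substitution for the last gap; the
        other factors do not involve \<open>v\<close>.\<close>
      have "?H (z(Suc d := v)) = ?p * ?f v" for v
      proof -
        have "(\<Prod>k=2..d. ennreal (from_gaps (Suc d) t (z(Suc d := v)) k) *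
            indicator {0..} ((z(Suc d := v)) k)) = ?p"
          by (rule prod.cong) (auto simp: from_gaps_Suc[OF d])
        then show ?thesis
          unfolding ins2 by (subst prod.insert) (simp_all add: from_gaps_Suc[OF d] mult_ac)
      qed
      moreover have "?f \<in> borel_measurable lborel"
      proof -
        have "from_gaps d t z \<in> space (?L {1..d})" by (simp add: space_PiM from_gaps_def)
        from measurable_compose[OF measurable_compose[OF measurable_Pair1'[OF this] upd] G]
        show ?thesis by simp
      qed
      ultimately show "(\<integral>\<^sup>+v. ?H (z(Suc d := v)) \<partial>lborel) = G' (from_gaps d t z) * ?p"
        by (simp add: nn_integral_cmult G'_def mult.commute)
    qed
    finally show "(\<integral>\<^sup>+z. G' (from_gaps d t z) *
      (\<Prod>k=2..d. ennreal (from_gaps d t z k) * indicator {0..} (z k)) \<partial>?L {2..d}) *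
      indicator {0<..} t = (\<integral>\<^sup>+z. ?H z \<partial>?L {2..Suc d}) * indicator {0<..} t"
      by simp
  qed
  finally show ?case .
qed

section \<open>From the simplex to a slab of the cone\<close>

lemma sets_PiM_lborel: "sets (PiM I (\<lambda>_. lborel)) = sets (PiM I (\<lambda>_. borel :: real measure))"
  by (intro sets_PiM_cong) auto

text \<open>
  A function that is homogeneous of degree \<open>- d\<close> has the same integral over every section
  \<open>\<Sum>k. x k = s\<close> up to the factor \<open>1 / s\<close>, and \<open>\<integral> 1 / s\<close> over \<open>{1..exp 1}\<close> is \<open>1\<close>.
\<close>

lemma nn_integral_simplex_eq_cone:
  fixes H :: "(nat \<Rightarrow> real) \<Rightarrow> ennreal"
  assumes d: "1 \<le> d" and H: "H \<in> borel_measurable (PiM {1..d} (\<lambda>_. lborel))"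
    and hom: "\<And>s x. 0 < s \<Longrightarrow> H (\<lambda>k\<in>{1..d}. s * x k) = ennreal (1 / s ^ d) * H (restrict x {1..d})"
  shows "(\<integral>\<^sup>+y. H (\<lambda>k\<in>{1..d}. if k < d then y k else 1 - (\<Sum>i=1..<d. y i))
      \<partial>PiM {1..<d} (\<lambda>_. lborel)) =
    (\<integral>\<^sup>+x. H x * ennreal (indicator {1..exp 1} (\<Sum>k=1..d. x k)) \<partial>PiM {1..d} (\<lambda>_. lborel))"
    (is "?J = ?R")
proof -
  let ?L = "\<lambda>I. PiM I (\<lambda>_::nat. lborel :: real measure)"
  \<comment> \<open>\<open>?c s\<close> parametrizes the section at level \<open>s\<close> by its
    first \<open>d - 1\<close> coordinates; at level 1 it is the chart of the simplex.\<close>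
  let ?c = "\<lambda>s y. \<lambda>k\<in>{1..d}. if k < d then y k else s - (\<Sum>i=1..<d. y i)"
  let ?\<phi> = "\<lambda>s. ennreal (indicator {1..exp (1::real)} (s::real))"
  interpret pair_sigma_finite lborel "?L {1..<d}"
    by (intro pair_sigma_finite.intro lborel.sigma_finite_measure_axioms
        lborel_prod.sigma_finite) auto
  have ins: "{1..d} = insert d {1..<d}" using d by auto
  have snd: "(\<lambda>p. snd p i) \<in> borel_measurable (lborel \<Otimes>\<^sub>M ?L {1..<d})" if "i \<in> {1..<d}" for i
    by (rule measurable_compose[OF measurable_snd measurable_coordinate[OF that]])
  have fst: "fst \<in> borel_measurable (lborel \<Otimes>\<^sub>M ?L {1..<d})"
    using measurable_fst[of "lborel :: real measure" "?L {1..<d}"] by simp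
  have cm: "(\<lambda>p. ?c (fst p) (snd p)) \<in> measurable (lborel \<Otimes>\<^sub>M ?L {1..<d}) (?L {1..d})"
  proof (rule measurable_restrict)
    fix k assume "k \<in> {1..d}"
    then show "(\<lambda>p. if k < d then snd p k else fst p - (\<Sum>i=1..<d. snd p i)) \<in>
        measurable (lborel \<Otimes>\<^sub>M ?L {1..<d}) lborel"
      using snd fst by (cases "k < d") (auto intro!: borel_measurable_diff borel_measurable_sum)
  qed
  have cs: "?c s \<in> measurable (?L {1..<d}) (?L {1..d})" for s
    using measurable_compose[OF measurable_Pair1'[of s lborel] cm] by (simp only: fst_conv snd_conv space_lborel space_borel UNIV_I)
  \<comment> \<open>The \<open>d - 1\<close> free coordinates contribute
    \<open>(1 / s) ^ (d - 1)\<close> and homogeneity contributes \<open>s ^ d\<close>, which leaves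
    \<open>s\<close>. The form \<open>s * 1\<close> matches
    \<open>nn_integral_inverse_scaled_interval\<close> at \<open>c = 1\<close>.\<close>
  have scale: "ennreal (indicator {1..exp 1} (s * 1) / s) * ?J =
      (\<integral>\<^sup>+x. ?\<phi> s * H (?c s x) \<partial>?L {1..<d})" for s :: real
  proof (cases "s \<in> {1..exp 1}")
    case True
    then have s: "0 < s" by simp
    have "?J = ennreal ((1 / s) ^ card {1..<d}) *
        (\<integral>\<^sup>+x. H (?c 1 (\<lambda>i\<in>{1..<d}. (1 / s) * x i)) \<partial>?L {1..<d})"
      using s by (intro nn_integral_PiM_lborel_scale measurable_compose[OF cs H]) auto
    also have "(\<lambda>x. ?c 1 (\<lambda>i\<in>{1..<d}. (1 / s) * x i)) = (\<lambda>x. \<lambda>k\<in>{1..d}. (1 / s) * ?c s x k)"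
      using s by (auto simp: fun_eq_iff diff_divide_distrib sum_divide_distrib[symmetric])
    also have "(\<lambda>x. H (\<lambda>k\<in>{1..d}. (1 / s) * ?c s x k)) = (\<lambda>x. ennreal (s ^ d) * H (?c s x))"
      using s by (subst hom) (auto simp: power_one_over)
    also have "(\<integral>\<^sup>+x. ennreal (s ^ d) * H (?c s x) \<partial>?L {1..<d}) =
        ennreal (s ^ d) * (\<integral>\<^sup>+x. H (?c s x) \<partial>?L {1..<d})"
      by (rule nn_integral_cmult) (rule measurable_compose[OF cs H])
    finally have "?J = ennreal ((1 / s) ^ (d - 1) * s ^ d) * (\<integral>\<^sup>+x. H (?c s x) \<partial>?L {1..<d})"
      using s by (simp add: ennreal_mult mult.assoc del: restrict_apply)
    also have "(1 / s) ^ (d - 1) * s ^ d = s"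
      using s d by (cases d) (auto simp: power_one_over)
    finally have J: "?J = ennreal s * (\<integral>\<^sup>+x. H (?c s x) \<partial>?L {1..<d})" .
    have "ennreal (1 / s) * ennreal s = 1"
      using s by (simp add: ennreal_mult[symmetric])
    then show ?thesis
      unfolding J using True by (simp add: mult.assoc[symmetric])
  qed simp
  have "?J = (\<integral>\<^sup>+s. ennreal (indicator {1..exp 1} (s * 1) / s) \<partial>lborel) * ?J"
    using nn_integral_inverse_scaled_interval[of 1] by simp
  also have "\<dots> = (\<integral>\<^sup>+s. ennreal (indicator {1..exp 1} (s * 1) / s) * ?J \<partial>lborel)"
    by (rule nn_integral_multc[symmetric]) measurable
  also have "\<dots> = (\<integral>\<^sup>+s. \<integral>\<^sup>+x. ?\<phi> s * H (?c s x) \<partial>?L {1..<d} \<partial>lborel)"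
    by (simp only: scale)
  also have "\<dots> = (\<integral>\<^sup>+x. \<integral>\<^sup>+s. ?\<phi> s * H (?c s x) \<partial>lborel \<partial>?L {1..<d})"
  proof (rule Fubini'[symmetric])
    show "(\<lambda>(s, x). ?\<phi> s * H (?c s x)) \<in> borel_measurable (lborel \<Otimes>\<^sub>M ?L {1..<d})"
      unfolding case_prod_beta'
      by (intro borel_measurable_times_ennreal measurable_compose[OF cm H]
          measurable_compose[OF _ measurable_ennreal]
          measurable_compose[OF fst borel_measurable_indicator]) auto
  qed
  also have "\<dots> = (\<integral>\<^sup>+x. \<integral>\<^sup>+w. H (x(d := w)) * ?\<phi> (\<Sum>k=1..d. (x(d := w)) k) \<partial>lborel \<partial>?L {1..<d})"
  proof (rule nn_integral_cong)
    fix x assume x: "x \<in> space (?L {1..<d})"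
    \<comment> \<open>The shift \<open>s = ?S + w\<close> trades the level for the last coordinate,
      so that the levels and the first \<open>d - 1\<close> coordinates together become points of
      the full space.\<close>
    let ?S = "\<Sum>i=1..<d. x i"
    have "(\<integral>\<^sup>+s. ?\<phi> s * H (?c s x) \<partial>lborel) = ennreal \<bar>1\<bar> * (\<integral>\<^sup>+w. ?\<phi> (?S + 1 * w) * H (?c (?S + 1 * w) x) \<partial>lborel)"
    proof (rule nn_integral_real_affine)
      have "(\<lambda>s. ?c s x) \<in> measurable lborel (?L {1..d})"
        using measurable_compose[OF measurable_Pair2'[OF x] cm] by (simp only: fst_conv snd_conv)
      from measurable_compose[OF this H]
      show "(\<lambda>s. ?\<phi> s * H (?c s x)) \<in> borel_measurable borel"
        by (intro borel_measurable_times_ennreal) auto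
    qed simp
    also have "\<dots> = (\<integral>\<^sup>+w. H (x(d := w)) * ?\<phi> (\<Sum>k=1..d. (x(d := w)) k) \<partial>lborel)"
    proof -
      have "?c (?S + w) x = x(d := w)" for w
        using x d by (auto simp: fun_eq_iff space_PiM PiE_def extensional_def)
      moreover have "(\<Sum>k=1..d. (x(d := w)) k) = ?S + w" for w
        unfolding ins by (simp add: sum.insert)
      ultimately show ?thesis by (simp add: mult.commute)
    qed
    finally show "(\<integral>\<^sup>+s. ?\<phi> s * H (?c s x) \<partial>lborel) =
      (\<integral>\<^sup>+w. H (x(d := w)) * ?\<phi> (\<Sum>k=1..d. (x(d := w)) k) \<partial>lborel)" .
  qed
  also have "\<dots> = ?R"
  proof -
    have "(\<lambda>x. H x * ?\<phi> (\<Sum>k=1..d. x k)) \<in> borel_measurable (?L {1..d})"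
      by (intro borel_measurable_times_ennreal H measurable_compose[OF _ measurable_ennreal]
          measurable_compose[OF _ borel_measurable_indicator[of "{1..exp 1}" borel]]
          borel_measurable_sum measurable_coordinate) auto
    then have "(\<lambda>x. H x * ?\<phi> (\<Sum>k=1..d. x k)) \<in> borel_measurable (?L (insert d {1..<d}))"
      by (simp only: ins)
    from lborel_prod.product_nn_integral_insert[OF _ _ this]
    show ?thesis by (simp only: ins) simp
  qed
  finally show ?thesis .
qed

section \<open>Log gaps under a homogeneous integrand\<close>

lemma measurable_log_gaps:
  "log_gaps d \<in> measurable (PiM {1..d} (\<lambda>_. borel)) (PiM {2..d} (\<lambda>_. borel))"
  unfolding log_gaps_def
proof (rule measurable_restrict)
  fix k assume "k \<in> {2..d}"
  then have "k - 1 \<in> {1..d}" "k \<in> {1..d}" by auto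
  then have [measurable]: "(\<lambda>y. y (k - 1)) \<in> borel_measurable (PiM {1..d} (\<lambda>_. borel :: real measure))"
    "(\<lambda>y. y k) \<in> borel_measurable (PiM {1..d} (\<lambda>_. borel :: real measure))"
    by (auto intro: measurable_component_singleton)
  show "(\<lambda>y. ln (y (k - 1)) - ln (y k)) \<in> borel_measurable (PiM {1..d} (\<lambda>_. borel :: real measure))"
    by measurable
qed

lemma log_gaps_from_gaps:
  assumes t: "0 < t" and z: "z \<in> extensional {2..d}"
  shows "log_gaps d (from_gaps d t z) = z"
proof
  fix k
  show "log_gaps d (from_gaps d t z) k = z k"
  proof (cases "k \<in> {2..d}")
    case True
    then have ins: "{2..k} = insert k {2..k - 1}" by auto
    have "(\<Sum>j=2..k. z j) = z k + (\<Sum>j=2..k - 1. z j)"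
      unfolding ins using True by (subst sum.insert) auto
    then show ?thesis
      using True t by (auto simp: log_gaps_def from_gaps_def ln_mult)
  next
    case False
    then show ?thesis using z by (auto simp: log_gaps_def extensional_def)
  qed
qed

text \<open>Summation by parts: the gap \<open>z j\<close> enters every coordinate with index
  \<open>k \<ge> j\<close>, so it collects the tail sum of the exponents from \<open>j\<close> on.
  This is the origin of the exponential rates.\<close>

lemma sum_mult_partial_sums:
  fixes b z :: "nat \<Rightarrow> real"
  shows "(\<Sum>k=1..d. b k * (\<Sum>j=2..k. z j)) = (\<Sum>j=2..d. tail_sum d b j * z j)"
proof -
  have "(\<Sum>k=1..d. b k * (\<Sum>j=2..k. z j)) = (\<Sum>k=1..d. \<Sum>j\<in>{j\<in>{2..d}. j \<le> k}. b k * z j)"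
    by (auto intro!: sum.cong simp: sum_distrib_left)
  also have "\<dots> = (\<Sum>j=2..d. \<Sum>k\<in>{k\<in>{1..d}. j \<le> k}. b k * z j)"
    by (rule sum.swap_restrict) auto
  also have "\<dots> = (\<Sum>j=2..d. tail_sum d b j * z j)"
    unfolding tail_sum_def sum_distrib_right by (intro sum.cong) auto
  finally show ?thesis .
qed

text \<open>The second product is the Jacobian factor from \<open>nn_integral_positive_cone\<close>.
  It cancels the \<open>- 1\<close> in the exponents for \<open>k \<ge> 2\<close>; the one for
  \<open>k = 1\<close> survives as \<open>1 / t\<close>, since the gap sum is empty there, and the
  remaining power of \<open>t\<close> has exponent \<open>tail_sum d b 1 = 0\<close>.\<close>

lemma prod_powr_from_gaps:
  fixes b z :: "nat \<Rightarrow> real"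
  assumes d: "1 \<le> d" and b: "tail_sum d b 1 = 0" and t: "0 < t"
  shows "(\<Prod>k=1..d. from_gaps d t z k powr (b k - 1)) * (\<Prod>k=2..d. from_gaps d t z k) =
    (\<Prod>k=2..d. exp (- tail_sum d b k * z k)) / t"
proof -
  define S where "S k = (\<Sum>j=2..k. z j)" for k
  have fg: "from_gaps d t z k = exp (ln t - S k)" if "k \<in> {1..d}" for k
    using that t by (simp add: from_gaps_def S_def exp_diff exp_minus field_simps)
  have "(\<Prod>k=1..d. from_gaps d t z k powr (b k - 1)) = exp (\<Sum>k=1..d. (b k - 1) * (ln t - S k))"
    unfolding exp_sum[OF finite_atLeastAtMost] by (intro prod.cong) (auto simp: fg powr_def)
  moreover have "(\<Prod>k=2..d. from_gaps d t z k) = exp (\<Sum>k=2..d. ln t - S k)"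
    unfolding exp_sum[OF finite_atLeastAtMost] by (intro prod.cong) (auto simp: fg)
  moreover have "(\<Sum>k=1..d. (b k - 1) * (ln t - S k)) + (\<Sum>k=2..d. ln t - S k) =
      (\<Sum>k=2..d. - tail_sum d b k * z k) - ln t"
  proof -
    have "{1..d} = insert 1 {2..d}" using d by auto
    then have "(\<Sum>k=1..d. ln t - S k) = ln t + (\<Sum>k=2..d. ln t - S k)"
      by (simp add: S_def)
    moreover have "(\<Sum>k=1..d. (b k - 1) * (ln t - S k)) =
        (\<Sum>k=1..d. b k) * ln t - (\<Sum>k=1..d. b k * S k) - (\<Sum>k=1..d. ln t - S k)"
      by (simp add: algebra_simps sum_subtractf sum.distrib sum_distrib_left)
    ultimately show ?thesis
      using b sum_mult_partial_sums[where b=b and z=z and d=d]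
      by (simp add: S_def tail_sum_def sum_negf)
  qed
  ultimately have "(\<Prod>k=1..d. from_gaps d t z k powr (b k - 1)) * (\<Prod>k=2..d. from_gaps d t z k) =
      exp ((\<Sum>k=2..d. - tail_sum d b k * z k) - ln t)"
    by (simp only: exp_add[symmetric])
  then show ?thesis
    using t by (simp only: exp_diff exp_ln exp_sum[OF finite_atLeastAtMost])
qed

text \<open>In gap coordinates the slab condition reads \<open>t * c \<in> {1..exp 1}\<close>, where
  \<open>c\<close> is the coordinate sum of \<open>from_gaps d 1 z\<close>, and it is the only link
  between \<open>t\<close> and \<open>z\<close>. Integrating over \<open>t\<close> first, against
  \<open>1 / t\<close>, gives 1 for every \<open>z\<close>, so only the product of exponentials
  remains as the weight of \<open>F\<close>.\<close>

lemma nn_integral_cone_eq_gaps: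
  fixes F :: "(nat \<Rightarrow> real) \<Rightarrow> ennreal"
  assumes d: "1 \<le> d" and b: "tail_sum d b 1 = 0"
    and F: "F \<in> borel_measurable (PiM {2..d} (\<lambda>_. borel))"
  shows "(\<integral>\<^sup>+x. ennreal (\<Prod>k=1..d. x k powr (b k - 1)) * F (log_gaps d x) *
      indicator (positive_cone d) x * ennreal (indicator {1..exp 1} (\<Sum>k=1..d. x k))
      \<partial>PiM {1..d} (\<lambda>_. lborel)) =
    (\<integral>\<^sup>+z. F z * (\<Prod>k=2..d. ennreal (exp (- tail_sum d b k * z k)) * indicator {0..} (z k))
      \<partial>PiM {2..d} (\<lambda>_. lborel))" (is "?l = ?r")
proof -
  let ?L = "\<lambda>I. PiM I (\<lambda>_::nat. lborel :: real measure)"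
  let ?\<phi> = "\<lambda>s::real. indicator {1..exp 1} s :: real"
  let ?W = "\<lambda>z. F z * (\<Prod>k=2..d. ennreal (exp (- tail_sum d b k * z k)) * indicator {0..} (z k))"
  let ?c = "\<lambda>z. \<Sum>k=1..d. exp (- (\<Sum>j=2..k. z j :: real))"
  define G where "G x = ennreal (\<Prod>k=1..d. x k powr (b k - 1)) * F (log_gaps d x) *
    ennreal (?\<phi> (\<Sum>k=1..d. x k))" for x
  interpret pair_sigma_finite lborel "?L {2..d}"
    by (intro pair_sigma_finite.intro lborel.sigma_finite_measure_axioms
        lborel_prod.sigma_finite) auto
  have FL: "F \<in> borel_measurable (?L {2..d})"
    using F by (simp cong: measurable_cong_sets add: sets_PiM_lborel)
  have lg: "log_gaps d \<in> measurable (?L {1..d}) (PiM {2..d} (\<lambda>_. borel))"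
    using measurable_log_gaps by (simp cong: measurable_cong_sets add: sets_PiM_lborel)
  have phi: "(\<lambda>s. ennreal (?\<phi> s)) \<in> borel_measurable borel"
    by measurable
  have G: "G \<in> borel_measurable (?L {1..d})"
    unfolding G_def
    by (intro borel_measurable_times_ennreal measurable_compose[OF lg F]
        measurable_compose[OF _ measurable_ennreal] measurable_compose[OF _ phi]
        borel_measurable_sum borel_measurable_prod powr_real_measurable
        borel_measurable_const measurable_coordinate) auto
  have Wmeas: "?W \<in> borel_measurable (?L {2..d})"
    by (intro borel_measurable_times_ennreal FL borel_measurable_prod_ennreal
        measurable_compose[OF _ measurable_ennreal] borel_measurable_exp borel_measurable_times
        measurable_compose[OF measurable_coordinate borel_measurable_indicator]
        borel_measurable_const measurable_coordinate) auto
  have cmeas: "?c \<in> borel_measurable (?L {2..d})"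
    by (intro borel_measurable_sum borel_measurable_exp borel_measurable_uminus
        measurable_coordinate) auto
  have cpos: "0 < ?c z" for z
    using d by (intro sum_pos) auto
  have "?l = (\<integral>\<^sup>+x. G x * indicator (positive_cone d) x \<partial>?L {1..d})"
    unfolding G_def by (intro nn_integral_cong) (simp add: mult_ac)
  also have "\<dots> = (\<integral>\<^sup>+t. (\<integral>\<^sup>+z. G (from_gaps d t z) *
      (\<Prod>k=2..d. ennreal (from_gaps d t z k) * indicator {0..} (z k)) \<partial>?L {2..d}) *
      indicator {0<..} t \<partial>lborel)"
    by (rule nn_integral_positive_cone[OF d G])
  also have "\<dots> = (\<integral>\<^sup>+t. (\<integral>\<^sup>+z. ?W z * ennreal (?\<phi> (t * ?c z) / t) \<partial>?L {2..d}) \<partial>lborel)"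
  proof (rule nn_integral_cong)
    fix t :: real
    show "(\<integral>\<^sup>+z. G (from_gaps d t z) *
      (\<Prod>k=2..d. ennreal (from_gaps d t z k) * indicator {0..} (z k)) \<partial>?L {2..d}) *
      indicator {0<..} t = (\<integral>\<^sup>+z. ?W z * ennreal (?\<phi> (t * ?c z) / t) \<partial>?L {2..d})"
    proof (cases "0 < t")
      case True
      have "G (from_gaps d t z) *
          (\<Prod>k=2..d. ennreal (from_gaps d t z k) * indicator {0..} (z k)) =
          ?W z * ennreal (?\<phi> (t * ?c z) / t)" if "z \<in> space (?L {2..d})" for z
      proof -
        have gaps: "log_gaps d (from_gaps d t z) = z"
          using that by (intro log_gaps_from_gaps[OF True]) (simp add: space_PiM PiE_def)
        have total: "(\<Sum>k=1..d. from_gaps d t z k) = t * ?c z"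
          by (simp add: from_gaps_def sum_distrib_left)
        have "ennreal (\<Prod>k=1..d. from_gaps d t z k powr (b k - 1)) *
            (\<Prod>k=2..d. ennreal (from_gaps d t z k)) =
            ennreal ((\<Prod>k=1..d. from_gaps d t z k powr (b k - 1)) * (\<Prod>k=2..d. from_gaps d t z k))"
          using True by (subst prod_ennreal)
            (auto simp: from_gaps_def intro!: ennreal_mult[symmetric] prod_nonneg)
        also have "\<dots> = (\<Prod>k=2..d. ennreal (exp (- tail_sum d b k * z k))) * ennreal (1 / t)"
          unfolding prod_powr_from_gaps[OF d b True]
          using True by (subst prod_ennreal)
            (auto simp: ennreal_mult[symmetric] prod_nonneg)
        finally have dens: "ennreal (\<Prod>k=1..d. from_gaps d t z k powr (b k - 1)) *
            (\<Prod>k=2..d. ennreal (from_gaps d t z k)) =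
            (\<Prod>k=2..d. ennreal (exp (- tail_sum d b k * z k))) * ennreal (1 / t)" .
        have phi_t: "ennreal (?\<phi> (t * ?c z) / t) = ennreal (?\<phi> (t * ?c z)) * ennreal (1 / t)"
          using True by (subst ennreal_mult[symmetric]) auto
        have "G (from_gaps d t z) *
          (\<Prod>k=2..d. ennreal (from_gaps d t z k) * indicator {0..} (z k)) =
          (ennreal (\<Prod>k=1..d. from_gaps d t z k powr (b k - 1)) *
            (\<Prod>k=2..d. ennreal (from_gaps d t z k))) *
          (F z * ennreal (?\<phi> (t * ?c z)) * (\<Prod>k=2..d. indicator {0..} (z k)))"
          by (simp only: G_def gaps total prod.distrib mult_ac)
        also have "\<dots> = ?W z * ennreal (?\<phi> (t * ?c z) / t)"
          unfolding dens phi_t by (simp only: prod.distrib mult_ac)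
        finally show ?thesis .
      qed
      then show ?thesis
        using True by (auto intro!: nn_integral_cong)
    next
      case False
      \<comment> \<open>For nonpositive \<open>t\<close> the slab condition fails because
        \<open>?c z\<close> is positive, so both sides vanish.\<close>
      have "t * ?c z \<le> 0" for z
        using False cpos[of z] by (intro mult_nonpos_nonneg) auto
      then have "t * ?c z \<notin> {1..exp 1}" for z
        by (meson atLeastAtMost_iff not_one_le_zero order_trans)
      then have "?\<phi> (t * ?c z) = 0" for z
        by (rule indicator_simps)
      then show ?thesis
        using False by (simp only:) simp
    qed
  qed
  also have "\<dots> = (\<integral>\<^sup>+z. (\<integral>\<^sup>+t. ?W z * ennreal (?\<phi> (t * ?c z) / t) \<partial>lborel) \<partial>?L {2..d})"
  proof (rule Fubini'[symmetric])
    have fst: "fst \<in> borel_measurable (lborel \<Otimes>\<^sub>M ?L {2..d})"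
      using measurable_fst[of "lborel :: real measure" "?L {2..d}"] by simp
    show "(\<lambda>(t, z). ?W z * ennreal (?\<phi> (t * ?c z) / t)) \<in> borel_measurable (lborel \<Otimes>\<^sub>M ?L {2..d})"
      unfolding case_prod_beta'
      by (intro borel_measurable_times_ennreal measurable_compose[OF measurable_snd Wmeas]
          measurable_compose[OF _ measurable_ennreal] borel_measurable_divide
          measurable_compose[OF _ borel_measurable_indicator[of "{1..exp 1}" borel]]
          borel_measurable_times fst measurable_compose[OF measurable_snd cmeas]) auto
  qed
  also have "\<dots> = ?r"
  proof (rule nn_integral_cong)
    fix z
    have "(\<integral>\<^sup>+t. ?W z * ennreal (?\<phi> (t * ?c z) / t) \<partial>lborel) =
        ?W z * (\<integral>\<^sup>+t. ennreal (?\<phi> (t * ?c z) / t) \<partial>lborel)"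
      by (rule nn_integral_cmult) measurable
    then show "(\<integral>\<^sup>+t. ?W z * ennreal (?\<phi> (t * ?c z) / t) \<partial>lborel) = ?W z"
      by (simp only: nn_integral_inverse_scaled_interval[OF cpos] mult_1_right)
  qed
  finally show ?thesis .
qed

lemma sets_ordered_simplex:
  assumes "1 \<le> d"
  shows "ordered_simplex d \<in> sets (PiM {1..d} (\<lambda>_. borel))"
proof -
  have c: "(\<lambda>x. x k) \<in> borel_measurable (PiM {1..d} (\<lambda>_. borel :: real measure))"
    if "k \<in> {1..d}" for k
    using that by (rule measurable_component_singleton)
  have "{y \<in> space (PiM {1..d} (\<lambda>_. borel)). (\<forall>k\<in>{1..<d}. y (Suc k) \<le> y k) \<and>
      0 \<le> y d \<and> (\<Sum>k=1..d. y k) = (1::real)} \<in> sets (PiM {1..d} (\<lambda>_. borel))"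
    using assms
    by (intro sets.sets_Collect_conj sets.sets_Collect_finite_All borel_measurable_le
        borel_measurable_eq borel_measurable_sum borel_measurable_const c) auto
  then show ?thesis
    by (simp add: ordered_simplex_def space_PiM)
qed

lemma measurable_simplex_chart:
  "(\<lambda>y. \<lambda>k\<in>{1..d}. if k < d then y k else 1 - (\<Sum>i=1..<d. y i)) \<in>
    measurable (PiM {1..<d} (\<lambda>_. lborel :: real measure)) (PiM {1..d} (\<lambda>_. borel))"
proof (rule measurable_restrict)
  fix k assume k: "k \<in> {1..d}"
  show "(\<lambda>y. if k < d then y k else 1 - (\<Sum>i=1..<d. y i)) \<in>
      borel_measurable (PiM {1..<d} (\<lambda>_. lborel :: real measure))"
  proof (cases "k < d")
    case True
    then show ?thesis using k measurable_coordinate[of k "{1..<d}"] by simp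
  next
    case False
    have "(\<lambda>y. 1 - (\<Sum>i=1..<d. y i)) \<in> borel_measurable (PiM {1..<d} (\<lambda>_. lborel :: real measure))"
      by (intro borel_measurable_diff borel_measurable_sum measurable_coordinate) auto
    with False show ?thesis by simp
  qed
qed

text \<open>The constant function \<open>F = 1\<close> yields the normalizing constant, and general
  \<open>F\<close> the law of the gaps. Homogeneity is available because scaling leaves log gaps
  unchanged and the exponents \<open>b k - 1\<close> add up to \<open>- d\<close>.\<close>

lemma nn_integral_simplex_log_gaps:
  fixes F :: "(nat \<Rightarrow> real) \<Rightarrow> ennreal"
  assumes d: "1 \<le> d" and b: "tail_sum d b 1 = 0"
    and F: "F \<in> borel_measurable (PiM {2..d} (\<lambda>_. borel))"
  shows "(\<integral>\<^sup>+y. ennreal (\<Prod>k=1..d. y k powr (b k - 1)) * F (log_gaps d y) \<partial>simplex_lebesgue d) =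
    (\<integral>\<^sup>+z. F z * (\<Prod>k=2..d. ennreal (exp (- tail_sum d b k * z k)) * indicator {0..} (z k))
      \<partial>PiM {2..d} (\<lambda>_. lborel))"
proof -
  let ?L = "\<lambda>I. PiM I (\<lambda>_::nat. lborel :: real measure)"
  let ?c = "\<lambda>y. \<lambda>k\<in>{1..d}. if k < d then y k else 1 - (\<Sum>i=1..<d. y i)"
  let ?f = "\<lambda>y. ennreal (\<Prod>k=1..d. y k powr (b k - 1)) * F (log_gaps d y)"
  define H where "H x = ?f x * indicator (positive_cone d) x" for x
  have f: "?f \<in> borel_measurable (PiM {1..d} (\<lambda>_. borel))"
    by (intro borel_measurable_times_ennreal measurable_compose[OF measurable_log_gaps F]
        measurable_compose[OF _ measurable_ennreal] borel_measurable_prod powr_real_measurable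
        borel_measurable_const measurable_component_singleton) auto
  then have fL: "?f \<in> borel_measurable (?L {1..d})"
    by (simp cong: measurable_cong_sets add: sets_PiM_lborel)
  have H: "H \<in> borel_measurable (?L {1..d})"
    unfolding H_def by (intro borel_measurable_times_ennreal fL measurable_indicator_positive_cone d)
  have ins: "{1..d} = insert d {1..<d}" using d by auto
  have hom: "H (\<lambda>k\<in>{1..d}. s * x k) = ennreal (1 / s ^ d) * H (restrict x {1..d})"
    if s: "0 < s" for s x
  proof -
    let ?x = "restrict x {1..d}" and ?sx = "\<lambda>k\<in>{1..d}. s * x k"
    have cone: "?sx \<in> positive_cone d \<longleftrightarrow> ?x \<in> positive_cone d"
      using s d by (simp add: positive_cone_def zero_less_mult_iff)
    show ?thesis
    proof (cases "?x \<in> positive_cone d")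
      case True
      have pos: "0 < x k" if "k \<in> {1..d}" for k
        using positive_cone_pos[OF True that] that by simp
      have "log_gaps d ?sx = log_gaps d ?x"
      proof
        fix k
        show "log_gaps d ?sx k = log_gaps d ?x k"
          using s pos[of k] pos[of "k - 1"] by (auto simp: log_gaps_def ln_mult)
      qed
      moreover have "ennreal (\<Prod>k=1..d. ?sx k powr (b k - 1)) =
          ennreal (1 / s ^ d) * ennreal (\<Prod>k=1..d. ?x k powr (b k - 1))"
      proof -
        have "(\<Prod>k=1..d. ?sx k powr (b k - 1)) =
            (\<Prod>k=1..d. s powr (b k - 1)) * (\<Prod>k=1..d. ?x k powr (b k - 1))"
          unfolding prod.distrib[symmetric]
          using s pos by (intro prod.cong) (auto simp: powr_mult less_imp_le)
        also have "(\<Prod>k=1..d. s powr (b k - 1)) = s powr (\<Sum>k=1..d. b k - 1)"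
          using s by (simp add: powr_sum)
        also have "(\<Sum>k=1..d. b k - 1) = - real d"
          using b by (simp add: tail_sum_def sum_subtractf)
        also have "s powr (- real d) = 1 / s ^ d"
          using s by (simp add: powr_minus powr_realpow field_simps)
        finally show ?thesis
          using s by (simp only:) (intro ennreal_mult', simp)
      qed
      ultimately show ?thesis
        using True cone by (simp add: H_def mult.assoc del: restrict_apply)
    next
      case False
      then have "?sx \<notin> positive_cone d" using cone by blast
      with False show ?thesis by (simp add: H_def del: restrict_apply One_nat_def)
    qed
  qed
  have "(\<integral>\<^sup>+y. ?f y \<partial>simplex_lebesgue d) =
      (\<integral>\<^sup>+y. ?f y * indicator (ordered_simplex d) y \<partial>hyperplane_lebesgue d)"
    unfolding simplex_lebesgue_def
    by (rule nn_integral_restrict_space)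
       (use sets_ordered_simplex[OF d] in \<open>auto simp: hyperplane_lebesgue_def\<close>)
  also have "\<dots> = (\<integral>\<^sup>+y. ?f (?c y) * indicator (ordered_simplex d) (?c y) \<partial>?L {1..<d})"
    unfolding hyperplane_lebesgue_def
  proof (rule nn_integral_distr[OF measurable_simplex_chart])
    show "(\<lambda>y. ?f y * indicator (ordered_simplex d) y) \<in>
        borel_measurable (distr (?L {1..<d}) (PiM {1..d} (\<lambda>_. borel)) ?c)"
      unfolding measurable_distr_eq1
      by (intro borel_measurable_times_ennreal f borel_measurable_indicator sets_ordered_simplex d)
  qed
  also have "\<dots> = (\<integral>\<^sup>+y. H (?c y) \<partial>?L {1..<d})"
  proof (rule nn_integral_cong)
    fix y :: "nat \<Rightarrow> real"
    have sum: "(\<Sum>k=1..d. ?c y k) = 1"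
      unfolding ins by (subst sum.insert) auto
    \<comment> \<open>On the hyperplane, simplex and cone differ only where the last coordinate is
      0, and there \<open>0 powr x = 0\<close> annihilates the integrand. So the two integrands
      agree at every point, not just almost everywhere.\<close>
    have "?c y \<in> ordered_simplex d \<longleftrightarrow> ?c y \<in> positive_cone d" if "?c y d \<noteq> 0"
      using that sum unfolding ordered_simplex_def positive_cone_def
      by (auto simp del: restrict_apply simp: less_le)
    moreover have "?f (?c y) = 0" if 0: "?c y d = 0"
    proof -
      have "(\<Prod>k=1..d. ?c y k powr (b k - 1)) = 0"
        using d 0 by (intro prod_zero bexI[of _ d]) (auto simp del: restrict_apply)
      then show ?thesis by (simp only: ennreal_0 mult_zero_left)
    qed
    ultimately show "?f (?c y) * indicator (ordered_simplex d) (?c y) = H (?c y)"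
      unfolding H_def by (cases "?c y d = 0") (auto simp: indicator_def simp del: restrict_apply)
  qed
  also have "\<dots> = (\<integral>\<^sup>+x. H x * ennreal (indicator {1..exp 1} (\<Sum>k=1..d. x k)) \<partial>?L {1..d})"
    by (rule nn_integral_simplex_eq_cone[OF d H hom])
  also have "\<dots> = (\<integral>\<^sup>+z. F z * (\<Prod>k=2..d. ennreal (exp (- tail_sum d b k * z k)) * indicator {0..} (z k))
      \<partial>?L {2..d})"
    unfolding H_def by (rule nn_integral_cone_eq_gaps[OF d b F])
  finally show ?thesis .
qed

section \<open>Multinomial expansion\<close>

text \<open>Dividing by factorials turns the multinomial formula into a convolution, and the
  induction step becomes the binomial theorem for the value at the new index. Finiteness of the
  index set is part of the same induction because the rearrangement of the sums relies on
  it.\<close>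

lemma sum_power_div_fact:
  fixes y :: "'a \<Rightarrow> 'b::field_char_0"
  assumes "finite S"
  shows "finite {m \<in> S \<rightarrow>\<^sub>E (UNIV :: nat set). sum m S = n} \<and>
    (\<Sum>k\<in>S. y k) ^ n / fact n =
    (\<Sum>m\<in>{m \<in> S \<rightarrow>\<^sub>E UNIV. sum m S = n}. \<Prod>k\<in>S. y k ^ m k / fact (m k))"
  using assms
proof (induction S arbitrary: n rule: finite_induct)
  case empty
  have "{m \<in> {} \<rightarrow>\<^sub>E (UNIV :: nat set). sum m {} = n} = (if n = 0 then {\<lambda>_. undefined} else {})"
    by auto
  then show ?case by (auto simp: power_0_left)
next
  case (insert x S)
  let ?W = "\<lambda>S n. {m \<in> S \<rightarrow>\<^sub>E (UNIV :: nat set). sum m S = n}"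
  let ?P = "\<lambda>S m. \<Prod>k\<in>S. y k ^ m k / fact (m k)"
  let ?D = "SIGMA j:{..n}. ?W S (n - j)"
  have upd: "sum (m(x := j)) S = sum m S" "?P S (m(x := j)) = ?P S m" for m and j :: nat
    using insert.hyps by (auto intro!: sum.cong prod.cong)
  \<comment> \<open>A composition on \<open>insert x S\<close> splits into its value at
    \<open>x\<close> and the rest; resetting \<open>x\<close> to \<open>undefined\<close> keeps the
    rest extensional on \<open>S\<close>.\<close>
  have bij: "bij_betw (\<lambda>(j, m). m(x := j)) ?D (?W (insert x S) n)"
  proof (rule bij_betw_byWitness[where f'="\<lambda>m. (m x, m(x := undefined))"])
    show "\<forall>p\<in>?D. (\<lambda>m. (m x, m(x := undefined))) ((\<lambda>(j, m). m(x := j)) p) = p"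
      using insert.hyps by (auto simp: fun_eq_iff PiE_def extensional_def)
    show "\<forall>m\<in>?W (insert x S) n. (\<lambda>(j, m). m(x := j)) (m x, m(x := undefined)) = m"
      by auto
    show "(\<lambda>(j, m). m(x := j)) ` ?D \<subseteq> ?W (insert x S) n"
      using insert.hyps upd(1) by (auto simp: PiE_def extensional_def)
    show "(\<lambda>m. (m x, m(x := undefined))) ` ?W (insert x S) n \<subseteq> ?D"
      using insert.hyps upd(1) by (auto simp: PiE_def extensional_def)
  qed
  have fin: "finite ?D"
    using insert.IH by auto
  have "(\<Sum>k\<in>insert x S. y k) ^ n / fact n =
      (\<Sum>j\<le>n. of_nat (n choose j) * y x ^ j * (\<Sum>k\<in>S. y k) ^ (n - j)) / fact n"
    using insert.hyps by (simp add: binomial_ring)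
  also have "\<dots> = (\<Sum>j\<le>n. (y x ^ j / fact j) * ((\<Sum>k\<in>S. y k) ^ (n - j) / fact (n - j)))"
    unfolding sum_divide_distrib by (intro sum.cong) (auto simp: binomial_fact field_simps)
  also have "\<dots> = (\<Sum>j\<le>n. \<Sum>m\<in>?W S (n - j). (y x ^ j / fact j) * ?P S m)"
    using insert.IH by (simp add: sum_distrib_left)
  also have "\<dots> = (\<Sum>(j, m)\<in>?D. (y x ^ j / fact j) * ?P S m)"
    using insert.IH by (subst sum.Sigma) auto
  also have "\<dots> = (\<Sum>p\<in>?D. ?P (insert x S) ((\<lambda>(j, m). m(x := j)) p))"
    using insert.hyps upd(2) by (intro sum.cong) auto
  also have "\<dots> = (\<Sum>m\<in>?W (insert x S) n. ?P (insert x S) m)"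
    by (rule sum.reindex_bij_betw[OF bij])
  finally show ?case
    using bij_betw_finite[OF bij] fin by blast
qed

lemma finite_weak_compositions: "finite (weak_compositions d M)"
  using sum_power_div_fact[of "{1..d}" M "\<lambda>_. 0 :: real"] by (simp add: weak_compositions_def tail_sum_def)

lemma sum_power_eq_multinomial:
  fixes y :: "nat \<Rightarrow> real"
  shows "(\<Sum>k=1..d. y k) ^ M =
    (\<Sum>m\<in>weak_compositions d M. multinomial d M m * (\<Prod>k=1..d. y k ^ m k))"
proof -
  have "(\<Sum>k=1..d. y k) ^ M / fact M =
      (\<Sum>m\<in>weak_compositions d M. \<Prod>k=1..d. y k ^ m k / fact (m k))"
    using sum_power_div_fact[of "{1..d}" M y] by (simp add: weak_compositions_def tail_sum_def)
  then have "(\<Sum>k=1..d. y k) ^ M =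
      fact M * (\<Sum>m\<in>weak_compositions d M. \<Prod>k=1..d. y k ^ m k / fact (m k))"
    by (simp add: field_simps)
  also have "\<dots> = (\<Sum>m\<in>weak_compositions d M. multinomial d M m * (\<Prod>k=1..d. y k ^ m k))"
    by (simp add: sum_distrib_left multinomial_def prod_dividef)
  finally show ?thesis .
qed

lemma multinomial_pos: "0 < multinomial d M m"
  by (auto simp: multinomial_def intro!: divide_pos_pos prod_pos)

text \<open>At the all-one vector the multinomial formula has the value \<open>d ^ M\<close>, which
  is not 0, whereas an empty sum would be 0.\<close>

lemma weak_compositions_nonempty:
  assumes "1 \<le> d"
  shows "weak_compositions d M \<noteq> {}"
  using assms sum_power_eq_multinomial[where d=d and M=M and y="\<lambda>_. 1"] by auto

lemma tail_sum_add_counts: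
  "tail_sum d (add_counts a m) k = tail_sum d a k + real (tail_sum d m k)"
  by (simp add: tail_sum_def add_counts_def sum.distrib)

lemma ordered_simplex_nonneg:
  assumes "y \<in> ordered_simplex d" "k \<in> {1..d}"
  shows "0 \<le> y k"
proof -
  from assms have "k \<le> d" by simp
  then show ?thesis
  proof (induction rule: inc_induct)
    case base
    then show ?case using assms by (simp add: ordered_simplex_def)
  next
    case (step n)
    then have "y (Suc n) \<le> y n" using assms by (auto simp: ordered_simplex_def)
    with step show ?case by simp
  qed
qed

text \<open>
  This is \<open>1 = (\<Sum>k. y k) ^ M\<close> expanded on the simplex. If a coordinate vanishes, then
  \<open>0 powr x = 0\<close> makes both sides zero.
\<close>

lemma grd_integrand_decomposition:
  assumes y: "y \<in> ordered_simplex d"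
  shows "(\<Prod>k=1..d. y k powr (a k - 1)) =
    (\<Sum>m\<in>weak_compositions d M. multinomial d M m * (\<Prod>k=1..d. y k powr (add_counts a m k - 1)))"
proof -
  have "(\<Prod>k=1..d. y k powr (add_counts a m k - 1)) =
      (\<Prod>k=1..d. y k ^ m k) * (\<Prod>k=1..d. y k powr (a k - 1))" for m
    unfolding prod.distrib[symmetric]
  proof (rule prod.cong[OF refl])
    fix k assume "k \<in> {1..d}"
    then have "y k = 0 \<or> 0 < y k" using ordered_simplex_nonneg[OF y] by force
    then show "y k powr (add_counts a m k - 1) = y k ^ m k * y k powr (a k - 1)"
    proof
      assume pos: "0 < y k"
      have "add_counts a m k - 1 = real (m k) + (a k - 1)" by (simp add: add_counts_def)
      then show ?thesis using pos by (simp only: powr_add powr_realpow)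
    qed simp
  qed
  then have "(\<Sum>m\<in>weak_compositions d M. multinomial d M m * (\<Prod>k=1..d. y k powr (add_counts a m k - 1))) =
      (\<Sum>k=1..d. y k) ^ M * (\<Prod>k=1..d. y k powr (a k - 1))"
    by (simp only: sum_power_eq_multinomial sum_distrib_right mult.assoc)
  then show ?thesis
    using y by (simp add: ordered_simplex_def)
qed

section \<open>Normalizing constants and gap laws for exponents with total 0\<close>

lemma sets_simplex_lebesgue:
  "sets (simplex_lebesgue d) = sets (restrict_space (PiM {1..d} (\<lambda>_. borel)) (ordered_simplex d))"
  unfolding simplex_lebesgue_def by (rule sets_restrict_space_cong) (simp add: hyperplane_lebesgue_def)

lemma space_simplex_lebesgue: "space (simplex_lebesgue d) = ordered_simplex d"
  by (auto simp: simplex_lebesgue_def hyperplane_lebesgue_def space_restrict_space space_PiM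
      ordered_simplex_def)

lemma measurable_simplex_lebesgue:
  assumes "f \<in> measurable (PiM {1..d} (\<lambda>_. borel :: real measure)) N"
  shows "f \<in> measurable (simplex_lebesgue d) N"
  using measurable_restrict_space1[OF assms, of "ordered_simplex d"]
  by (simp add: sets_simplex_lebesgue cong: measurable_cong_sets)

lemma measurable_grd_integrand:
  "(\<lambda>y. \<Prod>k=1..d. y k powr (b k - 1)) \<in> borel_measurable (simplex_lebesgue d)"
  by (intro measurable_simplex_lebesgue borel_measurable_prod powr_real_measurable
      borel_measurable_const measurable_component_singleton) auto

text \<open>The constant stays symbolic, as an \<open>inverse\<close> in \<open>ennreal\<close>; its
  value is inserted in \<open>log_gap_law_eq_PiM\<close>, where the tail sums are positive.\<close>

lemma nn_integral_log_gap_law: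
  fixes F :: "(nat \<Rightarrow> real) \<Rightarrow> ennreal"
  assumes d: "1 \<le> d" and b: "tail_sum d b 1 = 0"
    and F: "F \<in> borel_measurable (PiM {2..d} (\<lambda>_. borel))"
  shows "(\<integral>\<^sup>+z. F z \<partial>log_gap_law d b) = inverse (grd_constant d b) *
    (\<integral>\<^sup>+z. F z * (\<Prod>k=2..d. ennreal (exp (- tail_sum d b k * z k)) * indicator {0..} (z k))
      \<partial>PiM {2..d} (\<lambda>_. lborel))"
proof -
  let ?p = "\<lambda>y. \<Prod>k=1..d. y k powr (b k - 1)"
  have p: "(\<lambda>y. ennreal (?p y)) \<in> borel_measurable (simplex_lebesgue d)"
    by (rule measurable_compose[OF measurable_grd_integrand measurable_ennreal])
  have lg: "log_gaps d \<in> measurable (simplex_lebesgue d) (PiM {2..d} (\<lambda>_. borel))"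
    by (rule measurable_simplex_lebesgue[OF measurable_log_gaps])
  have "(\<integral>\<^sup>+z. F z \<partial>log_gap_law d b) = (\<integral>\<^sup>+y. F (log_gaps d y) \<partial>GRD d b)"
    unfolding log_gap_law_def
    by (rule nn_integral_distr) (use lg F in \<open>auto simp: GRD_def\<close>)
  also have "\<dots> = (\<integral>\<^sup>+y. ennreal (?p y) / grd_constant d b * F (log_gaps d y) \<partial>simplex_lebesgue d)"
    unfolding GRD_def
    by (intro nn_integral_density borel_measurable_divide_ennreal p borel_measurable_const
        measurable_compose[OF lg F])
  also have "\<dots> = (\<integral>\<^sup>+y. inverse (grd_constant d b) * (ennreal (?p y) * F (log_gaps d y)) \<partial>simplex_lebesgue d)"
    by (simp add: divide_ennreal_def mult_ac)
  also have "\<dots> = inverse (grd_constant d b) * (\<integral>\<^sup>+y. ennreal (?p y) * F (log_gaps d y) \<partial>simplex_lebesgue d)"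
    by (intro nn_integral_cmult borel_measurable_times_ennreal p measurable_compose[OF lg F])
  finally show ?thesis
    by (simp only: nn_integral_simplex_log_gaps[OF d b F])
qed

lemma ennreal_exponential_density:
  assumes "0 < l"
  shows "ennreal (exponential_density l z) = ennreal l * (ennreal (exp (- l * z)) * indicator {0..} z)"
  using assms by (auto simp: exponential_density_def ennreal_mult[symmetric] mult_ac split: split_indicator)

text \<open>The integral of the product is the product of the integrals, and each factor is read off
  from the total mass 1 of an exponential density. In particular the constant is finite and
  positive.\<close>

lemma grd_constant_eq:
  assumes d: "1 \<le> d" and b: "tail_sum d b 1 = 0"
    and pos: "\<And>k. k \<in> {2..d} \<Longrightarrow> 0 < tail_sum d b k"
  shows "grd_constant d b = ennreal (\<Prod>k=2..d. 1 / tail_sum d b k)"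
proof -
  let ?f = "\<lambda>k z. ennreal (exp (- tail_sum d b k * z)) * indicator {0..} (z :: real)"
  have int: "integral\<^sup>N lborel (?f k) = ennreal (1 / tail_sum d b k)" if k: "k \<in> {2..d}" for k
  proof -
    interpret prob_space "density lborel (exponential_density (tail_sum d b k))"
      using pos[OF k] by (rule prob_space_exponential_density)
    have "1 = (\<integral>\<^sup>+z. ennreal (exponential_density (tail_sum d b k) z) \<partial>lborel)"
      using emeasure_space_1 by (simp add: emeasure_density)
    also have "\<dots> = ennreal (tail_sum d b k) * integral\<^sup>N lborel (?f k)"
      by (simp only: ennreal_exponential_density[OF pos[OF k]]) (rule nn_integral_cmult, measurable)
    finally have "ennreal (1 / tail_sum d b k) =
        (ennreal (1 / tail_sum d b k) * ennreal (tail_sum d b k)) * integral\<^sup>N lborel (?f k)"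
      by (simp add: mult.assoc)
    also have "ennreal (1 / tail_sum d b k) * ennreal (tail_sum d b k) = 1"
      using pos[OF k] by (simp add: ennreal_mult[symmetric])
    finally show ?thesis by simp
  qed
  have "grd_constant d b = (\<integral>\<^sup>+z. (\<Prod>k=2..d. ?f k (z k)) \<partial>PiM {2..d} (\<lambda>_. lborel))"
    using nn_integral_simplex_log_gaps[OF d b, of "\<lambda>_. 1"] by (simp add: grd_constant_def)
  also have "\<dots> = (\<Prod>k=2..d. integral\<^sup>N lborel (?f k))"
    by (rule lborel_prod.product_nn_integral_prod) (simp, measurable)
  also have "\<dots> = (\<Prod>k=2..d. ennreal (1 / tail_sum d b k))"
    by (rule prod.cong[OF refl int])
  also have "\<dots> = ennreal (\<Prod>k=2..d. 1 / tail_sum d b k)"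
    by (rule prod_ennreal) (use pos in \<open>auto intro: less_imp_le\<close>)
  finally show ?thesis .
qed

lemma log_gap_law_eq_PiM:
  assumes d: "1 \<le> d" and b: "tail_sum d b 1 = 0"
    and pos: "\<And>k. k \<in> {2..d} \<Longrightarrow> 0 < tail_sum d b k"
  shows "log_gap_law d b =
    PiM {2..d} (\<lambda>k. density lborel (exponential_density (tail_sum d b k)))" (is "_ = PiM _ ?E")
proof -
  \<comment> \<open>The product family has to be sigma-finite at every index, while the rates are
    known to be positive only on \<open>{2..d}\<close>; \<open>lborel\<close> fills the other
    indices.\<close>
  define E where "E k = (if k \<in> {2..d} then ?E k else lborel)" for k
  let ?f = "\<lambda>k z. ennreal (exp (- tail_sum d b k * z)) * indicator {0..} (z :: real)"
  interpret E: product_sigma_finite E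
  proof (rule product_sigma_finite.intro)
    fix k
    show "sigma_finite_measure (E k)"
    proof (cases "k \<in> {2..d}")
      case True
      interpret prob_space "?E k" by (rule prob_space_exponential_density[OF pos[OF True]])
      show ?thesis using True sigma_finite_measure_axioms by (simp add: E_def)
    qed (auto simp: E_def lborel.sigma_finite_measure_axioms)
  qed
  have "log_gap_law d b = PiM {2..d} E"
  proof (rule E.PiM_eqI)
    show "sets (log_gap_law d b) = sets (PiM {2..d} E)"
      unfolding log_gap_law_def sets_distr by (rule sets_PiM_cong) (auto simp: E_def)
  next
    fix A assume A: "\<And>k. k \<in> {2..d} \<Longrightarrow> A k \<in> sets (E k)"
    then have Ab: "A k \<in> sets borel" if "k \<in> {2..d}" for k using that by (auto simp: E_def)
    have box: "Pi\<^sub>E {2..d} A \<in> sets (PiM {2..d} (\<lambda>_. borel))"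
      by (rule sets_PiM_I_finite) (auto intro: Ab)
    have "emeasure (log_gap_law d b) (Pi\<^sub>E {2..d} A) =
        (\<integral>\<^sup>+z. indicator (Pi\<^sub>E {2..d} A) z \<partial>log_gap_law d b)"
      using box by (subst nn_integral_indicator) (auto simp: log_gap_law_def)
    also have "\<dots> = inverse (grd_constant d b) *
      (\<integral>\<^sup>+z. indicator (Pi\<^sub>E {2..d} A) z * (\<Prod>k=2..d. ?f k (z k)) \<partial>PiM {2..d} (\<lambda>_. lborel))"
      by (rule nn_integral_log_gap_law[OF d b borel_measurable_indicator[OF box]])
    also have "(\<integral>\<^sup>+z. indicator (Pi\<^sub>E {2..d} A) z * (\<Prod>k=2..d. ?f k (z k)) \<partial>PiM {2..d} (\<lambda>_. lborel)) =
      (\<integral>\<^sup>+z. (\<Prod>k=2..d. ?f k (z k) * indicator (A k) (z k)) \<partial>PiM {2..d} (\<lambda>_. lborel))"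
    proof (rule nn_integral_cong)
      fix z assume z: "z \<in> space (PiM {2..d} (\<lambda>_. lborel :: real measure))"
      have "indicator (Pi\<^sub>E {2..d} A) z = (\<Prod>k=2..d. indicator (A k) (z k) :: ennreal)"
      proof (cases "z \<in> Pi\<^sub>E {2..d} A")
        case True
        then have "(\<Prod>k=2..d. indicator (A k) (z k) :: ennreal) = 1"
          by (intro prod.neutral) (auto simp: PiE_iff indicator_def)
        with True show ?thesis by simp
      next
        case False
        \<comment> \<open>Points of the product space are extensional, so leaving the box means
          leaving it in some coordinate.\<close>
        then obtain k where "k \<in> {2..d}" "z k \<notin> A k"
          using z by (auto simp: space_PiM PiE_iff)
        then show ?thesis using False by (auto intro!: prod_zero[symmetric] bexI[of _ k])
      qed
      then show "indicator (Pi\<^sub>E {2..d} A) z * (\<Prod>k=2..d. ?f k (z k)) =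
          (\<Prod>k=2..d. ?f k (z k) * indicator (A k) (z k))"
        by (simp only: prod.distrib mult_ac)
    qed
    also have "\<dots> = (\<Prod>k=2..d. \<integral>\<^sup>+z. ?f k z * indicator (A k) z \<partial>lborel)"
      by (rule lborel_prod.product_nn_integral_prod) (use Ab in auto)
    \<comment> \<open>The inverse constant splits into the rates, one to normalize each exponential
      factor.\<close>
    also have "inverse (grd_constant d b) = (\<Prod>k=2..d. ennreal (tail_sum d b k))"
    proof -
      have "0 < (\<Prod>k=2..d. 1 / tail_sum d b k)" using pos by (intro prod_pos) auto
      then have "inverse (grd_constant d b) = ennreal (inverse (\<Prod>k=2..d. 1 / tail_sum d b k))"
        using grd_constant_eq[OF d b pos] by (simp only: inverse_ennreal)
      also have "inverse (\<Prod>k=2..d. 1 / tail_sum d b k) = (\<Prod>k=2..d. tail_sum d b k)"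
        by (simp add: prod_dividef)
      also have "ennreal \<dots> = (\<Prod>k=2..d. ennreal (tail_sum d b k))"
        by (rule prod_ennreal[symmetric]) (use pos in \<open>auto intro: less_imp_le\<close>)
      finally show ?thesis .
    qed
    also have "(\<Prod>k=2..d. ennreal (tail_sum d b k)) *
        (\<Prod>k=2..d. \<integral>\<^sup>+z. ?f k z * indicator (A k) z \<partial>lborel) =
        (\<Prod>k=2..d. emeasure (E k) (A k))"
      unfolding prod.distrib[symmetric]
    proof (rule prod.cong[OF refl])
      fix k assume k: "k \<in> {2..d}"
      have [measurable]: "A k \<in> sets borel" by (rule Ab[OF k])
      have "emeasure (E k) (A k) =
          (\<integral>\<^sup>+z. ennreal (exponential_density (tail_sum d b k) z) * indicator (A k) z \<partial>lborel)"
        using k by (simp add: E_def emeasure_density)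
      also have "\<dots> = (\<integral>\<^sup>+z. ennreal (tail_sum d b k) * (?f k z * indicator (A k) z) \<partial>lborel)"
        by (simp only: ennreal_exponential_density[OF pos[OF k]] mult.assoc)
      also have "\<dots> = ennreal (tail_sum d b k) * (\<integral>\<^sup>+z. ?f k z * indicator (A k) z \<partial>lborel)"
        by (rule nn_integral_cmult) measurable
      finally show "ennreal (tail_sum d b k) * (\<integral>\<^sup>+z. ?f k z * indicator (A k) z \<partial>lborel) =
          emeasure (E k) (A k)" ..
    qed
    finally show "emeasure (log_gap_law d b) (Pi\<^sub>E {2..d} A) = (\<Prod>k=2..d. emeasure (E k) (A k))" .
  qed simp
  also have "\<dots> = PiM {2..d} ?E"
    by (rule PiM_cong) (auto simp: E_def)
  finally show ?thesis .
qed

lemma measurable_log_gaps_GRD: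
  "log_gaps d \<in> measurable (GRD d b) (PiM {2..d} (\<lambda>_. borel))"
  using measurable_simplex_lebesgue[OF measurable_log_gaps] by (simp add: GRD_def)

lemma measurable_GRD_iff:
  "f \<in> measurable (GRD d b) N \<longleftrightarrow> f \<in> measurable (simplex_lebesgue d) N"
  by (simp add: GRD_def)

lemma prob_space_GRD:
  assumes "grd_constant d b = ennreal q" "0 < q"
  shows "prob_space (GRD d b)"
proof
  have "emeasure (GRD d b) (space (GRD d b)) =
      (\<integral>\<^sup>+y. ennreal (\<Prod>k=1..d. y k powr (b k - 1)) / grd_constant d b \<partial>simplex_lebesgue d)"
  proof -
    have "(\<lambda>y. ennreal (\<Prod>k=1..d. y k powr (b k - 1)) / grd_constant d b) \<in>
        borel_measurable (simplex_lebesgue d)"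
      by (intro borel_measurable_divide_ennreal borel_measurable_const
          measurable_compose[OF measurable_grd_integrand measurable_ennreal])
    from emeasure_density[OF this sets.top] show ?thesis
      by (auto simp: GRD_def intro!: nn_integral_cong)
  qed
  also have "\<dots> = grd_constant d b / grd_constant d b"
    unfolding grd_constant_def
    by (rule nn_integral_divide) (rule measurable_compose[OF measurable_grd_integrand measurable_ennreal])
  also have "\<dots> = 1"
    using assms by (simp add: ennreal_divide_self)
  finally show "emeasure (GRD d b) (space (GRD d b)) = 1" .
qed

text \<open>With a finite positive constant the division takes place in the reals, which is the form
  that Bochner integrals need.\<close>

lemma GRD_eq_density:
  assumes "grd_constant d b = ennreal q" "0 < q"
  shows "GRD d b = density (simplex_lebesgue d)
    (\<lambda>y. ennreal ((\<Prod>k=1..d. y k powr (b k - 1)) / q))"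
  unfolding GRD_def assms(1)
proof (rule arg_cong[where f="density (simplex_lebesgue d)"], rule ext)
  fix y
  have "0 \<le> (\<Prod>k=1..d. y k powr (b k - 1))" by (simp add: prod_nonneg)
  then show "ennreal (\<Prod>k=1..d. y k powr (b k - 1)) / ennreal q =
      ennreal ((\<Prod>k=1..d. y k powr (b k - 1)) / q)"
    using assms(2) by (rule divide_ennreal)
qed

text \<open>Moves expectations to the common base measure \<open>simplex_lebesgue\<close>, so that
  different exponent vectors can be compared.\<close>

lemma
  fixes h :: "(nat \<Rightarrow> real) \<Rightarrow> real"
  assumes "grd_constant d b = ennreal q" "0 < q" and h: "h \<in> borel_measurable (simplex_lebesgue d)"
  shows integrable_GRD_iff: "integrable (GRD d b) h \<longleftrightarrow>
      integrable (simplex_lebesgue d) (\<lambda>y. (\<Prod>k=1..d. y k powr (b k - 1)) * h y)"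
    and integral_GRD: "(\<integral>y. h y \<partial>GRD d b) =
      (\<integral>y. (\<Prod>k=1..d. y k powr (b k - 1)) * h y \<partial>simplex_lebesgue d) / q"
proof -
  let ?p = "\<lambda>y. \<Prod>k=1..d. y k powr (b k - 1)"
  have m: "(\<lambda>y. ?p y / q) \<in> borel_measurable (simplex_lebesgue d)"
    by (intro borel_measurable_divide measurable_grd_integrand) auto
  have nn: "AE y in simplex_lebesgue d. 0 \<le> ?p y / q"
    using assms(2) by (intro AE_I2 divide_nonneg_pos prod_nonneg) auto
  have eq: "(\<lambda>y. (?p y / q) *\<^sub>R h y) = (\<lambda>y. (1 / q) * (?p y * h y))"
    by (auto simp: fun_eq_iff)
  show "integrable (GRD d b) h \<longleftrightarrow> integrable (simplex_lebesgue d) (\<lambda>y. ?p y * h y)"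
    unfolding GRD_eq_density[OF assms(1,2)] integrable_density[OF h m nn] eq
    using assms(2) by (subst integrable_mult_left_iff) auto
  show "(\<integral>y. h y \<partial>GRD d b) = (\<integral>y. ?p y * h y \<partial>simplex_lebesgue d) / q"
    unfolding GRD_eq_density[OF assms(1,2)] integral_density[OF h m nn] eq by simp
qed

text \<open>The joint law is a product of probability measures: its components are the marginals,
  and independence is the equality of the joint law with the product of the marginals.\<close>

lemma
  assumes d: "2 \<le> d" and b: "tail_sum d b 1 = 0"
    and pos: "\<And>k. k \<in> {2..d} \<Longrightarrow> 0 < tail_sum d b k"
  shows distributed_log_gaps: "k \<in> {2..d} \<Longrightarrow> distributed (GRD d b) lborel (\<lambda>y. log_gaps d y k)
      (exponential_density (tail_sum d b k))" (is "_ \<Longrightarrow> ?dist k")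
    and indep_vars_log_gaps: "prob_space.indep_vars (GRD d b) (\<lambda>_. borel) (\<lambda>k y. log_gaps d y k) {2..d}"
proof -
  let ?E = "\<lambda>k. density lborel (exponential_density (tail_sum d b k)) :: real measure"
  have d1: "1 \<le> d" using d by simp
  have "0 < (\<Prod>k=2..d. 1 / tail_sum d b k)" using pos by (intro prod_pos) auto
  then interpret prob_space "GRD d b"
    using grd_constant_eq[OF d1 b pos] by (intro prob_space_GRD) auto
  have law: "distr (GRD d b) (PiM {2..d} (\<lambda>_. borel)) (log_gaps d) = PiM {2..d} ?E"
    using log_gap_law_eq_PiM[OF d1 b pos] by (simp add: log_gap_law_def)
  have rv: "random_variable borel (\<lambda>y. log_gaps d y k)" if "k \<in> {2..d}" for k
    using measurable_compose[OF measurable_log_gaps_GRD measurable_component_singleton[OF that]] .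
  have marginal: "distr (GRD d b) borel (\<lambda>y. log_gaps d y k) = ?E k" if k: "k \<in> {2..d}" for k
  proof -
    have "distr (GRD d b) borel (\<lambda>y. log_gaps d y k) =
        distr (distr (GRD d b) (PiM {2..d} (\<lambda>_. borel)) (log_gaps d)) borel (\<lambda>z. z k)"
      using distr_distr[OF measurable_component_singleton[OF k] measurable_log_gaps_GRD]
      by (simp add: o_def)
    also have "\<dots> = distr (PiM {2..d} ?E) (?E k) (\<lambda>z. z k)"
      unfolding law by (rule distr_cong) auto
    also have "\<dots> = ?E k"
      by (rule distr_PiM_component) (use k pos prob_space_exponential_density in auto)
    finally show ?thesis .
  qed
  show "?dist k" if "k \<in> {2..d}"
    using marginal[OF that] rv[OF that]
    by (auto simp: distributed_def cong: distr_cong)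
  have gaps: "(\<lambda>y. \<lambda>k\<in>{2..d}. log_gaps d y k) = log_gaps d"
    by (auto simp: log_gaps_def fun_eq_iff)
  have marginals: "PiM {2..d} (\<lambda>k. distr (GRD d b) borel (\<lambda>y. log_gaps d y k)) = PiM {2..d} ?E"
    by (rule PiM_cong) (auto simp: marginal)
  have "distr (GRD d b) (PiM {2..d} (\<lambda>_. borel)) (\<lambda>y. \<lambda>k\<in>{2..d}. log_gaps d y k) =
      PiM {2..d} (\<lambda>k. distr (GRD d b) borel (\<lambda>y. log_gaps d y k))"
    by (simp only: gaps law marginals)
  \<comment> \<open>The bound \<open>2 \<le> d\<close> makes the index set nonempty.\<close>
  then show "indep_vars (\<lambda>_. borel) (\<lambda>k y. log_gaps d y k) {2..d}"
    using d rv by (subst indep_vars_iff_distr_eq_PiM') auto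
qed

section \<open>The mixture for exponents with total \<open>- M\<close>\<close>

theorem corollary10:
  fixes d M :: nat and a :: "nat \<Rightarrow> real"
  assumes "d \<ge> 2"
    and "\<And>k. k \<in> {2..d} \<Longrightarrow> tail_sum d a k > 0"
    and "M \<ge> 1"
    and "tail_sum d a 1 = - real M"
  shows
    "(\<forall>g :: (nat \<Rightarrow> real) \<Rightarrow> real.
        integrable (GRD d a) (\<lambda>y. g (log_gaps d y)) \<longrightarrow>
          (\<forall>m\<in>weak_compositions d M.
             integrable (GRD d (add_counts a m)) (\<lambda>y. g (log_gaps d y))) \<and>
          (\<integral>y. g (log_gaps d y) \<partial>GRD d a) =
            (\<Sum>m\<in>weak_compositions d M.
               weight d a M m * (\<integral>y. g (log_gaps d y) \<partial>GRD d (add_counts a m)))) \<and>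
     (\<forall>m\<in>weak_compositions d M. weight d a M m \<ge> 0) \<and>
     (\<Sum>m\<in>weak_compositions d M. weight d a M m) = 1 \<and>
     (\<forall>A\<in>sets (\<Pi>\<^sub>M k\<in>{2..d}. (borel :: real measure)).
        emeasure (log_gap_law d a) A =
          (\<Sum>m\<in>weak_compositions d M.
             ennreal (weight d a M m) * emeasure (log_gap_law d (add_counts a m)) A)) \<and>
     (\<forall>m\<in>weak_compositions d M.
        prob_space.indep_vars (GRD d (add_counts a m)) (\<lambda>_. borel)
          (\<lambda>k y. log_gaps d y k) {2..d} \<and>
        (\<forall>k\<in>{2..d}.
           distributed (GRD d (add_counts a m)) lborel (\<lambda>y. log_gaps d y k)
             (exponential_density (tail_sum d a k + real (tail_sum d m k)))))"
proof -
  let ?W = "weak_compositions d M" and ?b = "add_counts a" and ?S = "simplex_lebesgue d"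
  let ?p = "\<lambda>b y. \<Prod>k=1..d. y k powr (b k - 1) :: real"
  have d1: "1 \<le> d" using assms(1) by simp
  have b1: "tail_sum d (?b m) 1 = 0" if "m \<in> ?W" for m
    using that assms(4) by (simp add: tail_sum_add_counts weak_compositions_def)
  have bpos: "0 < tail_sum d (?b m) k" if "k \<in> {2..d}" for m k
    using assms(2)[OF that] by (simp add: tail_sum_add_counts)
  define q where "q m = (\<Prod>k=2..d. 1 / tail_sum d (?b m) k)" for m
  have qpos: "0 < q m" for m
    unfolding q_def using bpos by (intro prod_pos) auto
  have q: "grd_constant d (?b m) = ennreal (q m)" if "m \<in> ?W" for m
    unfolding q_def by (rule grd_constant_eq[OF d1 b1[OF that] bpos])
  \<comment> \<open>This will be the constant of \<open>a\<close>. The total of \<open>a\<close> is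
    \<open>- M\<close>, so \<open>grd_constant_eq\<close> applies to the vectors \<open>?b m\<close>
    but not to \<open>a\<close>; the value follows by integrating \<open>decomp\<close>.\<close>
  define Q where "Q = (\<Sum>m\<in>?W. multinomial d M m * q m)"
  have Qpos: "0 < Q"
    unfolding Q_def
    by (intro sum_pos finite_weak_compositions weak_compositions_nonempty d1 mult_pos_pos
        multinomial_pos qpos)
  have decomp: "?p a y = (\<Sum>m\<in>?W. multinomial d M m * ?p (?b m) y)" if "y \<in> space ?S" for y
    using that by (intro grd_integrand_decomposition) (simp add: space_simplex_lebesgue)
  have Q: "grd_constant d a = ennreal Q"
  proof -
    have "grd_constant d a =
        (\<integral>\<^sup>+y. (\<Sum>m\<in>?W. ennreal (multinomial d M m) * ennreal (?p (?b m) y)) \<partial>?S)"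
      unfolding grd_constant_def
    proof (rule nn_integral_cong)
      fix y assume "y \<in> space ?S"
      then show "ennreal (?p a y) = (\<Sum>m\<in>?W. ennreal (multinomial d M m) * ennreal (?p (?b m) y))"
        by (simp add: decomp ennreal_mult[symmetric] multinomial_pos less_imp_le prod_nonneg
            del: One_nat_def)
    qed
    also have "\<dots> = (\<Sum>m\<in>?W. \<integral>\<^sup>+y. ennreal (multinomial d M m) * ennreal (?p (?b m) y) \<partial>?S)"
      by (intro nn_integral_sum borel_measurable_times_ennreal borel_measurable_const
          measurable_compose[OF measurable_grd_integrand measurable_ennreal])
    also have "\<dots> = (\<Sum>m\<in>?W. ennreal (multinomial d M m) * grd_constant d (?b m))"
      unfolding grd_constant_def
      by (intro sum.cong refl nn_integral_cmult
          measurable_compose[OF measurable_grd_integrand measurable_ennreal])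
    also have "\<dots> = (\<Sum>m\<in>?W. ennreal (multinomial d M m * q m))"
      by (intro sum.cong) (auto simp: q ennreal_mult multinomial_pos qpos less_imp_le)
    also have "\<dots> = ennreal Q"
      unfolding Q_def by (intro sum_ennreal) (auto simp: multinomial_pos qpos less_imp_le)
    finally show ?thesis .
  qed
  have weight: "weight d a M m = multinomial d M m * q m / Q" for m
  proof -
    \<comment> \<open>The numerators \<open>tail_sum d a k\<close> in \<open>raw_weight\<close> do
      not depend on \<open>m\<close>, so they cancel in the quotient.\<close>
    have raw: "raw_weight d a M m = (\<Prod>k=2..d. tail_sum d a k) * (multinomial d M m * q m)" for m
      by (simp add: raw_weight_def q_def tail_sum_add_counts prod_dividef)
    have "0 < (\<Prod>k=2..d. tail_sum d a k)"
      using assms(2) by (intro prod_pos) auto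
    from less_imp_neq[OF this, symmetric] show ?thesis
      unfolding weight_def raw Q_def sum_distrib_left[symmetric]
      by (rule mult_divide_mult_cancel_left)
  qed
  have weight_nonneg: "0 \<le> weight d a M m" for m
    using qpos[of m] Qpos multinomial_pos[of d M m] by (simp add: weight less_imp_le)
  \<comment> \<open>Proved for integrands on the simplex instead of functions of the gaps:
    measurability is then required only of the composite \<open>g (log_gaps d y)\<close>, and
    indicators of preimages are covered too.\<close>
  have mixture: "integrable (GRD d (?b m)) h"
      "(\<integral>y. h y \<partial>GRD d a) = (\<Sum>m\<in>?W. weight d a M m * (\<integral>y. h y \<partial>GRD d (?b m)))"
    if "integrable (GRD d a) h" and m: "m \<in> ?W" for h :: "(nat \<Rightarrow> real) \<Rightarrow> real" and m
  proof -
    have h: "h \<in> borel_measurable ?S"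
      using borel_measurable_integrable[OF that(1)] by (simp only: measurable_GRD_iff)
    have inta: "integrable ?S (\<lambda>y. ?p a y * h y)"
      using that(1) integrable_GRD_iff[OF Q Qpos h] by simp
    \<comment> \<open>All terms of \<open>decomp\<close> are nonnegative, so each is bounded by the
      integrand for \<open>a\<close>; domination passes integrability on to
      \<open>?b m\<close>.\<close>
    have intm: "integrable ?S (\<lambda>y. ?p (?b m) y * h y)" if m: "m \<in> ?W" for m
    proof (rule Bochner_Integration.integrable_bound)
      show "integrable ?S (\<lambda>y. (1 / multinomial d M m) * (?p a y * h y))"
        using inta by (rule integrable_mult_right)
      show "(\<lambda>y. ?p (?b m) y * h y) \<in> borel_measurable ?S"
        by (intro borel_measurable_times measurable_grd_integrand h)
      show "AE y in ?S. norm (?p (?b m) y * h y) \<le> norm ((1 / multinomial d M m) * (?p a y * h y))"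
      proof (rule AE_I2)
        fix y assume y: "y \<in> space ?S"
        have nn: "0 \<le> ?p b y" for b by (simp add: prod_nonneg)
        have "multinomial d M m * ?p (?b m) y \<le> ?p a y"
          unfolding decomp[OF y]
          by (rule member_le_sum[OF m])
            (auto intro!: mult_nonneg_nonneg prod_nonneg simp: multinomial_pos less_imp_le finite_weak_compositions)
        then have "?p (?b m) y \<le> ?p a y / multinomial d M m"
          using multinomial_pos[of d M m] by (simp add: field_simps del: One_nat_def)
        then have "?p (?b m) y * \<bar>h y\<bar> \<le> ?p a y / multinomial d M m * \<bar>h y\<bar>"
          by (rule mult_right_mono) simp
        then show "norm (?p (?b m) y * h y) \<le> norm ((1 / multinomial d M m) * (?p a y * h y))"
          using nn[of a] nn[of "?b m"] multinomial_pos[of d M m]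
          by (simp add: abs_mult del: One_nat_def)
      qed
    qed
    show "integrable (GRD d (?b m)) h"
      using integrable_GRD_iff[OF q[OF m] qpos h] intm[OF m] by simp
    have "(\<integral>y. ?p a y * h y \<partial>?S) = (\<integral>y. (\<Sum>m\<in>?W. multinomial d M m * (?p (?b m) y * h y)) \<partial>?S)"
      by (intro Bochner_Integration.integral_cong refl)
        (simp only: decomp sum_distrib_right mult.assoc)
    also have "\<dots> = (\<Sum>m\<in>?W. multinomial d M m * (\<integral>y. ?p (?b m) y * h y \<partial>?S))"
      by (subst Bochner_Integration.integral_sum) (auto simp: intm simp del: One_nat_def)
    finally have "(\<integral>y. h y \<partial>GRD d a) =
        (\<Sum>m\<in>?W. multinomial d M m * (\<integral>y. ?p (?b m) y * h y \<partial>?S)) / Q"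
      using integral_GRD[OF Q Qpos h] by simp
    also have "\<dots> = (\<Sum>m\<in>?W. weight d a M m * (\<integral>y. h y \<partial>GRD d (?b m)))"
      unfolding sum_divide_distrib
    proof (rule sum.cong[OF refl])
      fix m assume m: "m \<in> ?W"
      show "multinomial d M m * (\<integral>y. ?p (?b m) y * h y \<partial>?S) / Q =
          weight d a M m * (\<integral>y. h y \<partial>GRD d (?b m))"
        using qpos[of m] by (simp add: integral_GRD[OF q[OF m] qpos h] weight del: One_nat_def)
    qed
    finally show "(\<integral>y. h y \<partial>GRD d a) = (\<Sum>m\<in>?W. weight d a M m * (\<integral>y. h y \<partial>GRD d (?b m)))" .
  qed
  have law: "emeasure (log_gap_law d a) A =
      (\<Sum>m\<in>?W. ennreal (weight d a M m) * emeasure (log_gap_law d (?b m)) A)"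
    if A: "A \<in> sets (PiM {2..d} (\<lambda>_. borel :: real measure))" for A
  proof -
    \<comment> \<open>The measure of \<open>A\<close> is the expectation of the indicator of
      \<open>?B\<close>, integrable because all measures involved are probability measures;
      \<open>mixture\<close> then gives the claim in the reals.\<close>
    let ?B = "log_gaps d -` A \<inter> ordered_simplex d"
    have B: "?B \<in> sets ?S"
      using measurable_sets[OF measurable_simplex_lebesgue[OF measurable_log_gaps] A]
      by (simp add: space_simplex_lebesgue)
    have em: "emeasure (log_gap_law d b) A = ennreal (\<integral>y. indicator ?B y \<partial>GRD d b)"
      "integrable (GRD d b) (indicator ?B :: _ \<Rightarrow> real)"
      if "grd_constant d b = ennreal r" "0 < r" for b r
    proof -
      interpret prob_space "GRD d b" by (rule prob_space_GRD[OF that])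
      have BG: "?B \<in> events" using B by (simp add: GRD_def)
      have sp: "space (GRD d b) = ordered_simplex d" by (simp add: GRD_def space_simplex_lebesgue)
      show "integrable (GRD d b) (indicator ?B :: _ \<Rightarrow> real)"
        using BG by (simp add: emeasure_eq_measure)
      show "emeasure (log_gap_law d b) A = ennreal (\<integral>y. indicator ?B y \<partial>GRD d b)"
        using BG A by (simp add: log_gap_law_def emeasure_distr[OF measurable_log_gaps_GRD] sp
            emeasure_eq_measure)
    qed
    \<comment> \<open>\<open>mixture\<close> is stated under \<open>m \<in> ?W\<close>;
      \<open>m0\<close> gives access to its identity of expectations.\<close>
    obtain m0 where m0: "m0 \<in> ?W" using weak_compositions_nonempty[OF d1] by blast
    have "emeasure (log_gap_law d a) A =
        ennreal (\<Sum>m\<in>?W. weight d a M m * (\<integral>y. indicator ?B y \<partial>GRD d (?b m)))"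
      using em(1)[OF Q Qpos] mixture(2)[OF em(2)[OF Q Qpos] m0] by simp
    also have "\<dots> = (\<Sum>m\<in>?W. ennreal (weight d a M m * (\<integral>y. indicator ?B y \<partial>GRD d (?b m))))"
      by (rule sum_ennreal[symmetric]) (auto intro!: mult_nonneg_nonneg weight_nonneg)
    also have "\<dots> = (\<Sum>m\<in>?W. ennreal (weight d a M m) * emeasure (log_gap_law d (?b m)) A)"
      by (intro sum.cong refl) (simp only: em(1)[OF q qpos] ennreal_mult'[OF weight_nonneg])
    finally show ?thesis .
  qed
  obtain m0 where m0: "m0 \<in> ?W" using weak_compositions_nonempty[OF d1] by blast
  have "(\<Sum>m\<in>?W. weight d a M m) = 1"
    using Qpos by (simp add: weight sum_divide_distrib[symmetric] Q_def[symmetric])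
  moreover have "prob_space.indep_vars (GRD d (?b m)) (\<lambda>_. borel) (\<lambda>k y. log_gaps d y k) {2..d} \<and>
      (\<forall>k\<in>{2..d}. distributed (GRD d (?b m)) lborel (\<lambda>y. log_gaps d y k)
        (exponential_density (tail_sum d a k + real (tail_sum d m k))))" if "m \<in> ?W" for m
    using distributed_log_gaps[OF assms(1) b1[OF that] bpos]
      indep_vars_log_gaps[OF assms(1) b1[OF that] bpos] by (simp add: tail_sum_add_counts)
  ultimately show ?thesis
    using mixture m0 weight_nonneg law by (intro conjI allI impI ballI) blast+
qed

end
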